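(* Let $(\mathfrak A[\|\cdot\|_{\mathfrak A}],\mathfrak A_0)$ and $(\mathfrak B[\|\cdot\|_{\mathfrak B}],\mathfrak B_0)$ be normed (resp. Banach) quasi *-algebras. Let $\alpha$ denote either the injective cross-norm $\lambda$ or the projective cross-norm $\gamma$ on $\mathfrak A\otimes\mathfrak B$, let $\mathfrak A\otimes_\alpha\mathfrak B$ be the resulting normed space and $\mathfrak A\widehat\otimes_\alpha\mathfrak B$ its completion. Then $(\mathfrak A\otimes_\alpha\mathfrak B,\mathfrak A_0\otimes\mathfrak B_0)$ is a normed quasi *-algebra, and $(\mathfrak A\widehat\otimes_\alpha\mathfrak B,\mathfrak A_0\otimes\mathfrak B_0)$, with the involution and the left and right multiplications by elements of $\mathfrak A_0\otimes\mathfrak B_0$ extended by continuity, is a Banach quasi *-algebra.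
   Context: All vector spaces are complex. A quasi *-algebra $(\mathfrak A,\mathfrak A_0)$ is a pair consisting of a vector space $\mathfrak A$ and a *-algebra $\mathfrak A_0$ contained in $\mathfrak A$ as a subspace, such that: (i) products $ax$ and $xa$ of $a\in\mathfrak A$ and $x\in\mathfrak A_0$ are always defined (in $\mathfrak A$) and bilinear, extending the multiplication of $\mathfrak A_0$; (ii) $(xa)y=x(ay)$ and $a(xy)=(ax)y$ for all $x,y\in\mathfrak A_0$, $a\in\mathfrak A$; (iii) an involution is defined on $\mathfrak A$, extending that of $\mathfrak A_0$, with $(ax)^*=x^*a^*$ and $(xa)^*=a^*x^*$. It is a normed quasi *-algebra if $\mathfrak A$ carries a norm $\|\cdot\|$ with $\|a^*\|=\|a\|$ for all $a\in\mathfrak A$, $\mathfrak A_0$ is dense in $\mathfrak A[\|\cdot\|]$, and for every $x\in\mathfrak A_0$ the map $R_x:a\mapsto ax$ is continuous on $\mathfrak A[\|\cdot\|]$; it is a Banach quasi *-algebra if moreover $\mathfrak A[\|\cdot\|]$ is complete. The tensor product quasi *-algebra $(\mathfrak A\otimes\mathfrak B,\mathfrak A_0\otimes\mathfrak B_0)$ has operations determined by $(a\otimes b)(x\otimes y)=ax\otimes by$, $(x\otimes y)(a\otimes b)=xa\otimes yb$, $(a\otimes b)^*=a^*\otimes b^*$ for $a\in\mathfrak A,b\in\mathfrak B,x\in\mathfrak A_0,y\in\mathfrak B_0$. For $z=\sum_{i=1}^n a_i\otimes b_i\in\mathfrak A\otimes\mathfrak B$: $\|z\|_\lambda=\sup\{|\sum_i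 f(a_i)g(b_i)|: f\in\mathfrak A^*,\ g\in\mathfrak B^*,\ \|f\|\le1,\ \|g\|\le1\}$ (topological duals), and $\|z\|_\gamma=\inf\sum_i\|a_i\|_{\mathfrak A}\|b_i\|_{\mathfrak B}$, the infimum being over all representations $z=\sum_i a_i\otimes b_i$. *)

theory Defs
  imports "HOL-Analysis.Analysis" "HOL-Library.Poly_Mapping"
begin

section \<open>Complex vector spaces\<close>

class complex_vector = ab_group_add +
  fixes scaleC :: "complex \<Rightarrow> 'a \<Rightarrow> 'a" (infixr \<open>*\<^sub>C\<close> 75)
  assumes scaleC_add_right: "c *\<^sub>C (x + y) = c *\<^sub>C x + c *\<^sub>C y"
    and scaleC_add_left: "(c + d) *\<^sub>C x = c *\<^sub>C x + d *\<^sub>C x"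
    and scaleC_scaleC: "c *\<^sub>C d *\<^sub>C x = (c * d) *\<^sub>C x"
    and scaleC_one: "1 *\<^sub>C x = x"

global_interpretation complex_vector: vector_space "scaleC :: complex \<Rightarrow> 'a \<Rightarrow> 'a::complex_vector"
  by unfold_locales
    (simp_all add: scaleC_add_right scaleC_add_left scaleC_scaleC scaleC_one)

global_interpretation complex_vector: vector_space_pair
  "scaleC :: complex \<Rightarrow> 'a \<Rightarrow> 'a::complex_vector" "scaleC :: complex \<Rightarrow> 'b \<Rightarrow> 'b::complex_vector"
  by unfold_locales

abbreviation clinear :: "('a::complex_vector \<Rightarrow> 'b::complex_vector) \<Rightarrow> bool"
  where "clinear \<equiv> Vector_Spaces.linear scaleC scaleC"

lemma clinear_iff:
  "clinear f \<longleftrightarrow> (\<forall>x y. f (x + y) = f x + f y) \<and> (\<forall>c x. f (c *\<^sub>C x) = c *\<^sub>C f x)"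
  by (simp add: Vector_Spaces.linear_iff complex_vector.vector_space_axioms)

instantiation complex :: complex_vector
begin
definition scaleC_complex :: "complex \<Rightarrow> complex \<Rightarrow> complex"
  where "scaleC_complex c z = c * z"
instance
  by standard (simp_all add: scaleC_complex_def algebra_simps)
end

instantiation poly_mapping :: (type, complex_vector) complex_vector
begin
lift_definition scaleC_poly_mapping ::
  "complex \<Rightarrow> ('a \<Rightarrow>\<^sub>0 'b) \<Rightarrow> ('a \<Rightarrow>\<^sub>0 'b)" is "\<lambda>c f k. c *\<^sub>C f k"
  by (erule finite_subset[rotated]) auto
instance
  by standard (transfer; simp add: fun_eq_iff complex_vector.scale_right_distrib
      complex_vector.scale_left_distrib)+
end


section \<open>Norms and their topology\<close>

text \<open>Norms are explicit functions rather than class operations, because a tensor product carries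
  two different ones.\<close>

locale complex_norm =
  fixes nrm :: "'a::complex_vector \<Rightarrow> real"
  assumes norm_eq_zero_iff: "nrm x = 0 \<longleftrightarrow> x = 0"
    and norm_triangle: "nrm (x + y) \<le> nrm x + nrm y"
    and norm_scale: "nrm (c *\<^sub>C x) = cmod c * nrm x"

definition norm_topology :: "('a::complex_vector \<Rightarrow> real) \<Rightarrow> 'a topology"
  where "norm_topology nrm = Metric_space.mtopology UNIV (\<lambda>x y. nrm (x - y))"

definition norm_complete :: "('a::complex_vector \<Rightarrow> real) \<Rightarrow> bool"
  where "norm_complete nrm \<longleftrightarrow> Metric_space.mcomplete UNIV (\<lambda>x y. nrm (x - y))"

definition topological_dual :: "('a::complex_vector \<Rightarrow> real) \<Rightarrow> ('a \<Rightarrow> complex) set"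
  where "topological_dual nrm =
    {f. clinear f \<and> continuous_map (norm_topology nrm) euclidean f}"

definition dual_norm :: "('a::complex_vector \<Rightarrow> real) \<Rightarrow> ('a \<Rightarrow> complex) \<Rightarrow> real"
  where "dual_norm nrm f = Sup {cmod (f a) |a. nrm a \<le> 1}"

definition is_completion ::
  "('v::complex_vector \<Rightarrow> real) \<Rightarrow> ('c::complex_vector \<Rightarrow> real) \<Rightarrow> ('v \<Rightarrow> 'c) \<Rightarrow> bool"
  where "is_completion nV nC \<iota> \<longleftrightarrow>
    complex_norm nC \<and> norm_complete nC \<and>
    clinear \<iota> \<and> (\<forall>v. nC (\<iota> v) = nV v) \<and> norm_topology nC closure_of (range \<iota>) = UNIV"


section \<open>Quasi *-algebras\<close>

locale star_algebra =
  fixes A0 :: "'a::complex_vector set"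
    and mult :: "'a \<Rightarrow> 'a \<Rightarrow> 'a" (infixl \<open>\<cdot>\<close> 70)
    and star :: "'a \<Rightarrow> 'a"
  assumes subspace: "complex_vector.subspace A0"
    and mult_closed: "x \<in> A0 \<Longrightarrow> y \<in> A0 \<Longrightarrow> x \<cdot> y \<in> A0"
    and star_closed: "x \<in> A0 \<Longrightarrow> star x \<in> A0"
    and alg_add_left: "x \<in> A0 \<Longrightarrow> y \<in> A0 \<Longrightarrow> z \<in> A0 \<Longrightarrow> (x + y) \<cdot> z = x \<cdot> z + y \<cdot> z"
    and alg_add_right: "x \<in> A0 \<Longrightarrow> y \<in> A0 \<Longrightarrow> z \<in> A0 \<Longrightarrow> x \<cdot> (y + z) = x \<cdot> y + x \<cdot> z"
    and alg_scale_left: "x \<in> A0 \<Longrightarrow> y \<in> A0 \<Longrightarrow> (c *\<^sub>C x) \<cdot> y = c *\<^sub>C (x \<cdot> y)"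
    and alg_scale_right: "x \<in> A0 \<Longrightarrow> y \<in> A0 \<Longrightarrow> x \<cdot> (c *\<^sub>C y) = c *\<^sub>C (x \<cdot> y)"
    and alg_assoc: "x \<in> A0 \<Longrightarrow> y \<in> A0 \<Longrightarrow> z \<in> A0 \<Longrightarrow> (x \<cdot> y) \<cdot> z = x \<cdot> (y \<cdot> z)"
    and alg_star_add: "x \<in> A0 \<Longrightarrow> y \<in> A0 \<Longrightarrow> star (x + y) = star x + star y"
    and alg_star_scale: "x \<in> A0 \<Longrightarrow> star (c *\<^sub>C x) = cnj c *\<^sub>C star x"
    and alg_star_star: "x \<in> A0 \<Longrightarrow> star (star x) = x"
    and alg_star_mult: "x \<in> A0 \<Longrightarrow> y \<in> A0 \<Longrightarrow> star (x \<cdot> y) = star y \<cdot> star x"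

text \<open>The ambient space is the whole type. The multiplication is partial: \<open>a \<cdot> b\<close> is only
  meaningful, and only constrained, if at least one factor lies in \<open>A0\<close>. One symbol suffices for the
  left and the right multiplication, as both extend the multiplication of \<open>A0\<close>.\<close>

locale quasi_star_algebra = star_algebra A0 mult star
  for A0 :: "'a::complex_vector set"
    and mult :: "'a \<Rightarrow> 'a \<Rightarrow> 'a" (infixl \<open>\<cdot>\<close> 70)
    and star :: "'a \<Rightarrow> 'a" +
  assumes right_mult_linear: "x \<in> A0 \<Longrightarrow> clinear (\<lambda>a. a \<cdot> x)"
    and left_mult_linear: "x \<in> A0 \<Longrightarrow> clinear (\<lambda>a. x \<cdot> a)"
    and mult_add_right: "x \<in> A0 \<Longrightarrow> y \<in> A0 \<Longrightarrow> a \<cdot> (x + y) = a \<cdot> x + a \<cdot> y"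
    and mult_scale_right: "x \<in> A0 \<Longrightarrow> a \<cdot> (c *\<^sub>C x) = c *\<^sub>C (a \<cdot> x)"
    and mult_add_left: "x \<in> A0 \<Longrightarrow> y \<in> A0 \<Longrightarrow> (x + y) \<cdot> a = x \<cdot> a + y \<cdot> a"
    and mult_scale_left: "x \<in> A0 \<Longrightarrow> (c *\<^sub>C x) \<cdot> a = c *\<^sub>C (x \<cdot> a)"
    and assoc_middle: "x \<in> A0 \<Longrightarrow> y \<in> A0 \<Longrightarrow> (x \<cdot> a) \<cdot> y = x \<cdot> (a \<cdot> y)"
    and assoc_right: "x \<in> A0 \<Longrightarrow> y \<in> A0 \<Longrightarrow> a \<cdot> (x \<cdot> y) = (a \<cdot> x) \<cdot> y"
    and star_add: "star (a + b) = star a + star b"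
    and star_scale: "star (c *\<^sub>C a) = cnj c *\<^sub>C star a"
    and star_star: "star (star a) = a"
    and star_mult_right: "x \<in> A0 \<Longrightarrow> star (a \<cdot> x) = star x \<cdot> star a"
    and star_mult_left: "x \<in> A0 \<Longrightarrow> star (x \<cdot> a) = star a \<cdot> star x"

locale normed_quasi_star_algebra =
  quasi_star_algebra A0 mult star + complex_norm nrm
  for nrm :: "'a::complex_vector \<Rightarrow> real"
    and A0 :: "'a set"
    and mult :: "'a \<Rightarrow> 'a \<Rightarrow> 'a" (infixl \<open>\<cdot>\<close> 70)
    and star :: "'a \<Rightarrow> 'a" +
  assumes norm_star: "nrm (star a) = nrm a"
    and dense: "norm_topology nrm closure_of A0 = UNIV"
    and right_mult_continuous:
      "x \<in> A0 \<Longrightarrow> continuous_map (norm_topology nrm) (norm_topology nrm) (\<lambda>a. a \<cdot> x)"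

locale Banach_quasi_star_algebra = normed_quasi_star_algebra nrm A0 mult star
  for nrm :: "'a::complex_vector \<Rightarrow> real"
    and A0 :: "'a set"
    and mult :: "'a \<Rightarrow> 'a \<Rightarrow> 'a"
    and star :: "'a \<Rightarrow> 'a" +
  assumes complete: "norm_complete nrm"


section \<open>The algebraic tensor product\<close>

definition tensor_relations ::
  "('a::complex_vector \<times> 'b::complex_vector \<Rightarrow>\<^sub>0 complex) set"
  where "tensor_relations =
    {Poly_Mapping.single (a + a', b) 1 - Poly_Mapping.single (a, b) 1
        - Poly_Mapping.single (a', b) 1 |a a' b. True} \<union>
    {Poly_Mapping.single (a, b + b') 1 - Poly_Mapping.single (a, b) 1
        - Poly_Mapping.single (a, b') 1 |a b b'. True} \<union>
    {Poly_Mapping.single (c *\<^sub>C a, b) 1 - Poly_Mapping.single (a, b) c |a b c. True} \<union>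
    {Poly_Mapping.single (a, c *\<^sub>C b) 1 - Poly_Mapping.single (a, b) c |a b c. True}"

quotient_type (overloaded) ('a, 'b) tensor =
  "('a::complex_vector \<times> 'b::complex_vector) \<Rightarrow>\<^sub>0 complex" /
  "\<lambda>p q. p - q \<in> complex_vector.span tensor_relations"
proof (rule equivpI)
  let ?S = "complex_vector.span (tensor_relations :: ('a \<times> 'b \<Rightarrow>\<^sub>0 complex) set)"
  show "reflp (\<lambda>p q. p - q \<in> ?S)"
    by (simp add: reflp_def complex_vector.span_zero)
  show "symp (\<lambda>p q. p - q \<in> ?S)"
    by (metis (no_types, lifting) complex_vector.span_neg minus_diff_eq sympI)
  show "transp (\<lambda>p q. p - q \<in> ?S)"
  proof (rule transpI)
    fix p q r assume "p - q \<in> ?S" "q - r \<in> ?S"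
    then have "(p - q) + (q - r) \<in> ?S" by (rule complex_vector.span_add)
    then show "p - r \<in> ?S" by simp
  qed
qed

instantiation tensor :: (complex_vector, complex_vector) complex_vector
begin

lift_definition zero_tensor :: "('a, 'b) tensor" is 0 .

lift_definition plus_tensor :: "('a, 'b) tensor \<Rightarrow> ('a, 'b) tensor \<Rightarrow> ('a, 'b) tensor" is "(+)"
  by (metis (no_types, lifting) add_diff_add complex_vector.span_add)

lift_definition minus_tensor :: "('a, 'b) tensor \<Rightarrow> ('a, 'b) tensor \<Rightarrow> ('a, 'b) tensor" is "(-)"
proof -
  fix p p' q q' :: "'a \<times> 'b \<Rightarrow>\<^sub>0 complex"
  assume "p - p' \<in> complex_vector.span tensor_relations"
    "q - q' \<in> complex_vector.span tensor_relations"
  then have "(p - p') - (q - q') \<in> complex_vector.span tensor_relations"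
    by (rule complex_vector.span_diff)
  then show "(p - q) - (p' - q') \<in> complex_vector.span tensor_relations"
    by (simp add: algebra_simps)
qed

lift_definition uminus_tensor :: "('a, 'b) tensor \<Rightarrow> ('a, 'b) tensor" is uminus
  by (metis (no_types, lifting) complex_vector.span_neg minus_diff_minus)

lift_definition scaleC_tensor :: "complex \<Rightarrow> ('a, 'b) tensor \<Rightarrow> ('a, 'b) tensor" is scaleC
  by (metis (no_types, lifting) complex_vector.scale_right_diff_distrib complex_vector.span_scale)

instance
  by standard (transfer; simp add: algebra_simps complex_vector.span_zero
      complex_vector.scale_right_distrib complex_vector.scale_left_distrib)+

end

lift_definition tensor_elem ::
  "'a::complex_vector \<Rightarrow> 'b::complex_vector \<Rightarrow> ('a, 'b) tensor" (infixr \<open>\<otimes>\<close> 75)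
  is "\<lambda>a b. Poly_Mapping.single (a, b) 1" .

definition tensor_sum :: "('a::complex_vector \<times> 'b::complex_vector) list \<Rightarrow> ('a, 'b) tensor"
  where "tensor_sum r = (\<Sum>(a, b)\<leftarrow>r. a \<otimes> b)"

lemma tensor_add_left: "(a + a') \<otimes> b = a \<otimes> b + a' \<otimes> b"
proof -
  have "Poly_Mapping.single (a + a', b) 1 - Poly_Mapping.single (a, b) 1
      - Poly_Mapping.single (a', b) (1::complex) \<in> complex_vector.span tensor_relations"
    unfolding tensor_relations_def
    by (rule complex_vector.span_base, rule UnI1, rule UnI1, rule UnI1, intro CollectI exI conjI TrueI, rule refl)
  then show ?thesis
    by (simp only: tensor_elem.abs_eq plus_tensor.abs_eq tensor.abs_eq_iff diff_diff_eq)
qed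

lemma tensor_add_right: "a \<otimes> (b + b') = a \<otimes> b + a \<otimes> b'"
proof -
  have "Poly_Mapping.single (a, b + b') 1 - Poly_Mapping.single (a, b) 1
      - Poly_Mapping.single (a, b') (1::complex) \<in> complex_vector.span tensor_relations"
    unfolding tensor_relations_def
    by (rule complex_vector.span_base, rule UnI1, rule UnI1, rule UnI2, intro CollectI exI conjI TrueI, rule refl)
  then show ?thesis
    by (simp only: tensor_elem.abs_eq plus_tensor.abs_eq tensor.abs_eq_iff diff_diff_eq)
qed

lemma scaleC_single: "c *\<^sub>C Poly_Mapping.single k v = Poly_Mapping.single k (c *\<^sub>C v)"
  by (rule poly_mapping_eqI) (simp add: scaleC_poly_mapping.rep_eq lookup_single when_def)

lemma tensor_scale_left: "(c *\<^sub>C a) \<otimes> b = c *\<^sub>C (a \<otimes> b)"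
proof -
  have "Poly_Mapping.single (c *\<^sub>C a, b) 1 - Poly_Mapping.single (a, b) c
      \<in> complex_vector.span tensor_relations"
    unfolding tensor_relations_def
    by (rule complex_vector.span_base, rule UnI1, rule UnI2, intro CollectI exI conjI TrueI, rule refl)
  then show ?thesis
    by (simp add: tensor_elem.abs_eq scaleC_tensor.abs_eq tensor.abs_eq_iff scaleC_single
        scaleC_complex_def)
qed

lemma tensor_scale_right: "a \<otimes> (c *\<^sub>C b) = c *\<^sub>C (a \<otimes> b)"
proof -
  have "Poly_Mapping.single (a, c *\<^sub>C b) 1 - Poly_Mapping.single (a, b) c
      \<in> complex_vector.span tensor_relations"
    unfolding tensor_relations_def
    by (rule complex_vector.span_base, rule UnI2, intro CollectI exI conjI TrueI, rule refl)
  then show ?thesis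
    by (simp add: tensor_elem.abs_eq scaleC_tensor.abs_eq tensor.abs_eq_iff scaleC_single
        scaleC_complex_def)
qed

text \<open>Independence of the representation, i.e. the universal property. The map \<open>\<sigma>\<close> is the identity
  for linear maps and complex conjugation for conjugate-linear ones.\<close>

lemma tensor_sum_well_defined:
  fixes h :: "'a::complex_vector \<Rightarrow> 'b::complex_vector \<Rightarrow> 'w::complex_vector"
  assumes \<sigma>: "\<sigma> = id \<or> \<sigma> = cnj"
    and al: "\<And>a a' b. h (a + a') b = h a b + h a' b"
    and ar: "\<And>a b b'. h a (b + b') = h a b + h a b'"
    and sl: "\<And>c a b. h (c *\<^sub>C a) b = \<sigma> c *\<^sub>C h a b"
    and sr: "\<And>c a b. h a (c *\<^sub>C b) = \<sigma> c *\<^sub>C h a b"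
    and eq: "tensor_sum r = tensor_sum s"
  shows "(\<Sum>(a, b)\<leftarrow>r. h a b) = (\<Sum>(a, b)\<leftarrow>s. h a b)"
proof -
  have \<sigma>0: "\<sigma> x = 0 \<longleftrightarrow> x = 0" and \<sigma>1: "\<sigma> 1 = 1" and \<sigma>add: "\<sigma> (x + y) = \<sigma> x + \<sigma> y"
    and \<sigma>mult: "\<sigma> (x * y) = \<sigma> x * \<sigma> y" for x y
    using \<sigma> by auto
  define F :: "('a \<times> 'b \<Rightarrow>\<^sub>0 complex) \<Rightarrow> 'w"
    where "F p = (\<Sum>k\<in>Poly_Mapping.keys p. \<sigma> (Poly_Mapping.lookup p k) *\<^sub>C h (fst k) (snd k))" for p
  have F_super: "F p = (\<Sum>k\<in>K. \<sigma> (Poly_Mapping.lookup p k) *\<^sub>C h (fst k) (snd k))"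
    if "finite K" "Poly_Mapping.keys p \<subseteq> K" for p K
    unfolding F_def using that
    by (intro sum.mono_neutral_left) (auto simp: \<sigma>0 in_keys_iff)
  have F_add: "F (p + q) = F p + F q" for p q
  proof -
    let ?K = "Poly_Mapping.keys p \<union> Poly_Mapping.keys q"
    have "F (p + q) = (\<Sum>k\<in>?K. \<sigma> (Poly_Mapping.lookup (p + q) k) *\<^sub>C h (fst k) (snd k))"
      by (rule F_super) (use keys_add[of p q] in auto)
    also have "\<dots> = (\<Sum>k\<in>?K. \<sigma> (Poly_Mapping.lookup p k) *\<^sub>C h (fst k) (snd k))
        + (\<Sum>k\<in>?K. \<sigma> (Poly_Mapping.lookup q k) *\<^sub>C h (fst k) (snd k))"
      by (simp add: lookup_add \<sigma>add scaleC_add_left sum.distrib)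
    also have "\<dots> = F p + F q"
      by (subst (1 2) F_super[of ?K]) auto
    finally show ?thesis .
  qed
  have F_scale: "F (c *\<^sub>C p) = \<sigma> c *\<^sub>C F p" for c p
  proof -
    have "F (c *\<^sub>C p) = (\<Sum>k\<in>Poly_Mapping.keys p.
        \<sigma> (Poly_Mapping.lookup (c *\<^sub>C p) k) *\<^sub>C h (fst k) (snd k))"
      by (rule F_super)
        (auto simp: in_keys_iff scaleC_poly_mapping.rep_eq scaleC_complex_def)
    then show ?thesis
      by (simp add: F_def scaleC_poly_mapping.rep_eq scaleC_complex_def \<sigma>mult
          complex_vector.scale_sum_right scaleC_scaleC)
  qed
  have F_0: "F 0 = 0" by (simp add: F_def)
  have F_minus: "F (p - q) = F p - F q" for p q
    using F_add[of "p - q" q] by (simp add: algebra_simps)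
  have F_single: "F (Poly_Mapping.single (a, b) c) = \<sigma> c *\<^sub>C h a b" for a b c
    by (auto simp: F_def \<sigma>0)
  have F_rel: "F p = 0" if "p \<in> complex_vector.span tensor_relations" for p
    using that
  proof (induction rule: complex_vector.span_induct_alt)
    case base
    show ?case by (rule F_0)
  next
    case (step c p q)
    have "F p = 0"
      using step(1) unfolding tensor_relations_def
      by (auto simp: F_minus F_single al ar sl sr \<sigma>1 scaleC_one)
    then show ?case using step(2) by (simp add: F_add F_scale)
  qed
  let ?G = "\<lambda>t. (\<Sum>(a, b)\<leftarrow>t. Poly_Mapping.single (a, b) (1::complex))"
  have G: "tensor_sum t = abs_tensor (?G t)" for t :: "('a \<times> 'b) list"
  proof (induction t)
    case Nil
    show ?case by (simp add: tensor_sum_def zero_tensor.abs_eq)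
  next
    case (Cons k t)
    then show ?case
      by (simp add: tensor_sum_def plus_tensor.abs_eq tensor_elem.abs_eq split_beta)
  qed
  have FG: "F (?G t) = (\<Sum>(a, b)\<leftarrow>t. h a b)" for t
    by (induction t) (auto simp: F_0 F_add F_single \<sigma>1 scaleC_one)
  have "?G r - ?G s \<in> complex_vector.span tensor_relations"
    using eq unfolding G by (simp add: tensor.abs_eq_iff)
  then have "F (?G r - ?G s) = 0" by (rule F_rel)
  then show ?thesis by (simp add: F_minus FG)
qed

definition tensor_subspace ::
  "'a::complex_vector set \<Rightarrow> 'b::complex_vector set \<Rightarrow> ('a, 'b) tensor set"
  where "tensor_subspace A0 B0 = complex_vector.span {x \<otimes> y |x y. x \<in> A0 \<and> y \<in> B0}"


section \<open>Operations and norms on the tensor product\<close>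

text \<open>The values \<open>THE w\<close> are the ones obtained from any admissible representation as a sum of
  elementary tensors; that they do not depend on the representation is
  \<open>tensor_star_sum\<close> and \<open>tensor_mult_sum\<close> below.\<close>

definition tensor_star ::
  "('a::complex_vector \<Rightarrow> 'a) \<Rightarrow> ('b::complex_vector \<Rightarrow> 'b) \<Rightarrow> ('a, 'b) tensor \<Rightarrow> ('a, 'b) tensor"
  where "tensor_star sA sB z =
    (THE w. \<exists>r. z = tensor_sum r \<and> w = (\<Sum>(a, b)\<leftarrow>r. sA a \<otimes> sB b))"

definition tensor_mult ::
  "'a::complex_vector set \<Rightarrow> ('a \<Rightarrow> 'a \<Rightarrow> 'a) \<Rightarrow> 'b::complex_vector set \<Rightarrow> ('b \<Rightarrow> 'b \<Rightarrow> 'b) \<Rightarrow>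
    ('a, 'b) tensor \<Rightarrow> ('a, 'b) tensor \<Rightarrow> ('a, 'b) tensor"
  where "tensor_mult A0 mA B0 mB z z' =
    (THE w. \<exists>r s. z = tensor_sum r \<and> z' = tensor_sum s \<and>
      (set r \<subseteq> A0 \<times> B0 \<or> set s \<subseteq> A0 \<times> B0) \<and>
      w = (\<Sum>(a, b)\<leftarrow>r. \<Sum>(x, y)\<leftarrow>s. mA a x \<otimes> mB b y))"

lemma tensor_star_sum:
  assumes A: "quasi_star_algebra A0 mA sA" and B: "quasi_star_algebra B0 mB sB"
  shows "tensor_star sA sB (tensor_sum r) = (\<Sum>(a, b)\<leftarrow>r. sA a \<otimes> sB b)"
proof -
  interpret A: quasi_star_algebra A0 mA sA by (rule A)
  interpret B: quasi_star_algebra B0 mB sB by (rule B)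
  have wd: "(\<Sum>(a, b)\<leftarrow>s. sA a \<otimes> sB b) = (\<Sum>(a, b)\<leftarrow>r. sA a \<otimes> sB b)"
    if "tensor_sum r = tensor_sum s" for s
    by (rule tensor_sum_well_defined[where \<sigma> = cnj])
      (auto simp: that A.star_add B.star_add A.star_scale B.star_scale
        tensor_add_left tensor_add_right tensor_scale_left tensor_scale_right)
  show ?thesis
    unfolding tensor_star_def
  proof (rule the_equality)
    show "\<exists>s. tensor_sum r = tensor_sum s \<and>
        (\<Sum>(a, b)\<leftarrow>r. sA a \<otimes> sB b) = (\<Sum>(a, b)\<leftarrow>s. sA a \<otimes> sB b)"
      by (intro exI[of _ r] conjI refl)
  qed (elim exE conjE, hypsubst, rule wd)
qed

lemma tensor_mult_sum:
  assumes A: "quasi_star_algebra A0 mA sA" and B: "quasi_star_algebra B0 mB sB"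
    and rs: "set r \<subseteq> A0 \<times> B0 \<or> set s \<subseteq> A0 \<times> B0"
  shows "tensor_mult A0 mA B0 mB (tensor_sum r) (tensor_sum s) =
    (\<Sum>(a, b)\<leftarrow>r. \<Sum>(x, y)\<leftarrow>s. mA a x \<otimes> mB b y)"
proof -
  interpret A: quasi_star_algebra A0 mA sA by (rule A)
  interpret B: quasi_star_algebra B0 mB sB by (rule B)
  let ?m = "\<lambda>r s. \<Sum>(a, b)\<leftarrow>r. \<Sum>(x, y)\<leftarrow>s. mA a x \<otimes> mB b y"
  note bilin = tensor_add_left tensor_add_right tensor_scale_left tensor_scale_right
  have proj: "\<exists>P. clinear P \<and> range P \<subseteq> V \<and> (\<forall>v\<in>V. P v = v)"
    if "complex_vector.subspace V" for V :: "'v::complex_vector set"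
    using complex_vector.linear_exists_left_inverse_on[OF complex_vector.linear_id that] by auto
  obtain P where P: "clinear P" "range P \<subseteq> A0" "\<And>v. v \<in> A0 \<Longrightarrow> P v = v"
    using proj[OF A.subspace] by blast
  obtain Q where Q: "clinear Q" "range Q \<subseteq> B0" "\<And>v. v \<in> B0 \<Longrightarrow> Q v = v"
    using proj[OF B.subspace] by blast
  have PA: "P v \<in> A0" and QB: "Q w \<in> B0" for v w using P(2) Q(2) by auto
  note lin = P(1)[unfolded clinear_iff] Q(1)[unfolded clinear_iff]
  have add: "(\<Sum>(x, y)\<leftarrow>s. f x y + g x y) = (\<Sum>(x, y)\<leftarrow>s. f x y) + (\<Sum>(x, y)\<leftarrow>s. g x y)"
    for s and f g :: "'x \<Rightarrow> 'y \<Rightarrow> ('a, 'b) tensor"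
    by (induction s) (auto simp: algebra_simps)
  have swap: "?m r s = (\<Sum>(x, y)\<leftarrow>s. \<Sum>(a, b)\<leftarrow>r. mA a x \<otimes> mB b y)" for r s
    by (induction r) (auto simp: add)
  have scale: "(\<Sum>(x, y)\<leftarrow>s. c *\<^sub>C f x y) = c *\<^sub>C (\<Sum>(x, y)\<leftarrow>s. f x y)"
    for s c and f :: "'x \<Rightarrow> 'y \<Rightarrow> ('a, 'b) tensor"
    by (induction s) (auto simp: scaleC_add_right)
  have cong: "(\<Sum>(x, y)\<leftarrow>s. f x y) = (\<Sum>(x, y)\<leftarrow>s. g x y)"
    if "\<And>x y. (x, y) \<in> set s \<Longrightarrow> f x y = g x y" for s and f g :: "'x \<Rightarrow> 'y \<Rightarrow> ('a, 'b) tensor"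
    using that by (intro arg_cong[of _ _ sum_list] map_cong) auto
  have left: "?m r s = ?m r' s"
    if "tensor_sum r = tensor_sum r'" "set s \<subseteq> A0 \<times> B0" for r r' s
  proof -
    let ?h = "\<lambda>a b. \<Sum>(x, y)\<leftarrow>s. mA a (P x) \<otimes> mB b (Q y)"
    have "(\<Sum>(a, b)\<leftarrow>r. ?h a b) = (\<Sum>(a, b)\<leftarrow>r'. ?h a b)"
      using A.right_mult_linear[OF PA] B.right_mult_linear[OF QB] that(1)
      by (intro tensor_sum_well_defined[where \<sigma> = id])
        (simp_all add: clinear_iff bilin add scale)
    moreover have "?m t s = (\<Sum>(a, b)\<leftarrow>t. ?h a b)" for t
      by (intro cong) (use that(2) P(3) Q(3) in auto)
    ultimately show ?thesis by simp
  qed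
  have right: "?m r s = ?m r s'"
    if "tensor_sum s = tensor_sum s'" "set r \<subseteq> A0 \<times> B0" for r s s'
  proof -
    let ?h = "\<lambda>x y. \<Sum>(a, b)\<leftarrow>r. mA (P a) x \<otimes> mB (Q b) y"
    have "(\<Sum>(x, y)\<leftarrow>s. ?h x y) = (\<Sum>(x, y)\<leftarrow>s'. ?h x y)"
      using A.left_mult_linear[OF PA] B.left_mult_linear[OF QB] that(1)
      by (intro tensor_sum_well_defined[where \<sigma> = id])
        (simp_all add: clinear_iff bilin add scale)
    moreover have "?m r t = (\<Sum>(x, y)\<leftarrow>t. ?h x y)" for t
      unfolding swap by (intro cong) (use that(2) P(3) Q(3) in auto)
    ultimately show ?thesis by simp
  qed
  have left': "?m r s = ?m r s'"
    if "tensor_sum s = tensor_sum s'" "set s \<subseteq> A0 \<times> B0" "set s' \<subseteq> A0 \<times> B0" for r s s'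
  proof -
    let ?h = "\<lambda>x y. \<Sum>(a, b)\<leftarrow>r. mA a (P x) \<otimes> mB b (Q y)"
    have "(\<Sum>(x, y)\<leftarrow>s. ?h x y) = (\<Sum>(x, y)\<leftarrow>s'. ?h x y)"
      using that(1) lin
      by (intro tensor_sum_well_defined[where \<sigma> = id])
        (simp_all add: PA QB A.mult_add_right A.mult_scale_right B.mult_add_right
          B.mult_scale_right bilin add scale)
    moreover have "?m r t = (\<Sum>(x, y)\<leftarrow>t. ?h x y)" if "set t \<subseteq> A0 \<times> B0" for t
      unfolding swap by (intro cong) (use that P(3) Q(3) in auto)
    ultimately show ?thesis using that by simp
  qed
  have right': "?m r s = ?m r' s"
    if "tensor_sum r = tensor_sum r'" "set r \<subseteq> A0 \<times> B0" "set r' \<subseteq> A0 \<times> B0" for r r' s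
  proof -
    let ?h = "\<lambda>a b. \<Sum>(x, y)\<leftarrow>s. mA (P a) x \<otimes> mB (Q b) y"
    have "(\<Sum>(a, b)\<leftarrow>r. ?h a b) = (\<Sum>(a, b)\<leftarrow>r'. ?h a b)"
      using that(1) lin
      by (intro tensor_sum_well_defined[where \<sigma> = id])
        (simp_all add: PA QB A.mult_add_left A.mult_scale_left B.mult_add_left
          B.mult_scale_left bilin add scale)
    moreover have "?m t s = (\<Sum>(a, b)\<leftarrow>t. ?h a b)" if "set t \<subseteq> A0 \<times> B0" for t
      by (intro cong) (use that P(3) Q(3) in auto)
    ultimately show ?thesis using that by simp
  qed
  have wd: "?m r' s' = ?m r s"
    if eq: "tensor_sum r = tensor_sum r'" "tensor_sum s = tensor_sum s'"
      and adm: "set r' \<subseteq> A0 \<times> B0 \<or> set s' \<subseteq> A0 \<times> B0" for r' s'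
    using rs adm
  proof (elim disjE)
    assume "set r \<subseteq> A0 \<times> B0" "set r' \<subseteq> A0 \<times> B0"
    then show ?thesis
      using right[OF eq(2), of r] right'[OF eq(1), of s'] by simp
  next
    assume "set r \<subseteq> A0 \<times> B0" "set s' \<subseteq> A0 \<times> B0"
    then show ?thesis
      using right[OF eq(2), of r] left[OF eq(1), of s'] by simp
  next
    assume "set s \<subseteq> A0 \<times> B0" "set r' \<subseteq> A0 \<times> B0"
    then show ?thesis
      using left[OF eq(1), of s] right[OF eq(2), of r'] by simp
  next
    assume "set s \<subseteq> A0 \<times> B0" "set s' \<subseteq> A0 \<times> B0"
    then show ?thesis
      using left[OF eq(1), of s] left'[OF eq(2), of r'] by simp
  qed
  show ?thesis
    unfolding tensor_mult_def
  proof (rule the_equality)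
    show "\<exists>r' s'. tensor_sum r = tensor_sum r' \<and> tensor_sum s = tensor_sum s' \<and>
        (set r' \<subseteq> A0 \<times> B0 \<or> set s' \<subseteq> A0 \<times> B0) \<and> ?m r s = ?m r' s'"
      by (intro exI[of _ r] exI[of _ s] conjI refl rs)
  qed (elim exE conjE, hypsubst, rule wd)
qed

corollary tensor_star_elem:
  assumes "quasi_star_algebra A0 mA sA" "quasi_star_algebra B0 mB sB"
  shows "tensor_star sA sB (a \<otimes> b) = sA a \<otimes> sB b"
  using tensor_star_sum[OF assms, of "[(a, b)]"] by (simp add: tensor_sum_def)

corollary tensor_mult_elem:
  assumes "quasi_star_algebra A0 mA sA" "quasi_star_algebra B0 mB sB"
    and "a \<in> A0 \<and> b \<in> B0 \<or> x \<in> A0 \<and> y \<in> B0"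
  shows "tensor_mult A0 mA B0 mB (a \<otimes> b) (x \<otimes> y) = mA a x \<otimes> mB b y"
  using tensor_mult_sum[OF assms(1,2), of "[(a, b)]" "[(x, y)]"] assms(3)
  by (simp add: tensor_sum_def)

text \<open>The sum \<open>\<Sum> f(a\<^sub>i) g(b\<^sub>i)\<close> is the same for all representations of \<open>z\<close>, so letting \<open>r\<close> range over
  all of them does not affect the supremum.\<close>

definition injective_norm ::
  "('a::complex_vector \<Rightarrow> real) \<Rightarrow> ('b::complex_vector \<Rightarrow> real) \<Rightarrow> ('a, 'b) tensor \<Rightarrow> real"
  where "injective_norm nA nB z =
    Sup {cmod (\<Sum>(a, b)\<leftarrow>r. f a * g b) |r f g. z = tensor_sum r \<and>
      f \<in> topological_dual nA \<and> g \<in> topological_dual nB \<and>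
      dual_norm nA f \<le> 1 \<and> dual_norm nB g \<le> 1}"

definition projective_norm ::
  "('a::complex_vector \<Rightarrow> real) \<Rightarrow> ('b::complex_vector \<Rightarrow> real) \<Rightarrow> ('a, 'b) tensor \<Rightarrow> real"
  where "projective_norm nA nB z = Inf {(\<Sum>(a, b)\<leftarrow>r. nA a * nB b) |r. z = tensor_sum r}"

definition extended_by_continuity ::
  "('c::complex_vector \<Rightarrow> real) \<Rightarrow> ('v::complex_vector \<Rightarrow> 'c) \<Rightarrow>
    'v set \<Rightarrow> ('v \<Rightarrow> 'v \<Rightarrow> 'v) \<Rightarrow> ('v \<Rightarrow> 'v) \<Rightarrow> ('c \<Rightarrow> 'c \<Rightarrow> 'c) \<Rightarrow> ('c \<Rightarrow> 'c) \<Rightarrow> bool"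
  where "extended_by_continuity nC \<iota> V0 mV sV mC sC \<longleftrightarrow>
    continuous_map (norm_topology nC) (norm_topology nC) sC \<and>
    (\<forall>v. sC (\<iota> v) = \<iota> (sV v)) \<and>
    (\<forall>x\<in>V0.
      continuous_map (norm_topology nC) (norm_topology nC) (\<lambda>u. mC u (\<iota> x)) \<and>
      continuous_map (norm_topology nC) (norm_topology nC) (\<lambda>u. mC (\<iota> x) u) \<and>
      (\<forall>v. mC (\<iota> v) (\<iota> x) = \<iota> (mV v x) \<and> mC (\<iota> x) (\<iota> v) = \<iota> (mV x v)))"

end

(*
Both norms are cross norms that are compatible with tensor products of bounded linear, and of
bounded conjugate-linear, maps. Applied to a \<mapsto> a*, to multiplications by elements of A0 and B0 and to
differences of elementary tensors, this gives the isometric involution, the continuity of the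
multiplications and the density of the tensor product of A0 and B0. Definiteness of the injective
norm (hence of the larger projective norm) rests on Hahn--Banach: if all slices of a representation
by bounded functionals vanish, the representation can be shortened until it is empty.
On the completion every axiom is an identity between continuous maps that holds on a dense set.
*)
theory Submission
  imports Defs
begin

section \<open>Norm topologies\<close>

text \<open>Only multiplication by one fixed element of the subalgebra is known to be continuous, so
  products on the completion do not come from extending a single jointly continuous bilinear map.
  Each multiplier gets its own extended operator, and identities are carried over one argument at a
  time. The identity \<open>mult x a = star (mult (star a) (star x))\<close> turns left
  multiplications into right ones; it supplies their continuity and halves the axioms to be checked.
  The involution is conjugate-linear. Hence the estimates for maps of the factors carry a twist
  \<sigma> of the scalars, either the identity or conjugation, and maps are extended to the
  completion as Lipschitz maps, without reference to linearity. Hahn-Banach only has to produce a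
  functional of norm at most one that is nonzero at a given point. How large it is there is
  irrelevant, which permits working with half the norm and shortens the passage from real to complex
  functionals.\<close>

context complex_norm
begin

lemma nrm_zero [simp]: "nrm 0 = 0"
  by (simp add: norm_eq_zero_iff)

lemma nrm_minus [simp]: "nrm (- x) = nrm x"
  using norm_scale[of "-1" x] by (simp add: scaleC_one)

lemma nrm_diff_commute: "nrm (x - y) = nrm (y - x)"
  using nrm_minus[of "x - y"] by simp

lemma nrm_nonneg [simp]: "0 \<le> nrm x"
  using norm_triangle[of x "- x"] by simp

lemma nrm_pos: "x \<noteq> 0 \<Longrightarrow> 0 < nrm x"
  using nrm_nonneg[of x] norm_eq_zero_iff[of x] by linarith

lemma nrm_triangle_sub: "nrm (x - z) \<le> nrm (x - y) + nrm (y - z)"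
  using norm_triangle[of "x - y" "y - z"] by simp

lemma Metric_space_nrm: "Metric_space UNIV (\<lambda>x y. nrm (x - y))"
proof
  show "nrm (x - y) = nrm (y - x)" for x y by (rule nrm_diff_commute)
qed (simp_all add: norm_eq_zero_iff nrm_triangle_sub)

lemma closure_of_eq_UNIV_iff:
  "norm_topology nrm closure_of S = UNIV \<longleftrightarrow> (\<forall>u. \<forall>e>0. \<exists>v\<in>S. nrm (u - v) < e)"
proof -
  interpret Metric_space UNIV "\<lambda>x y. nrm (x - y)" by (rule Metric_space_nrm)
  show ?thesis
    unfolding norm_topology_def metric_closure_of by (simp add: set_eq_iff Bex_def)
qed

lemma norm_complete_iff:
  "norm_complete nrm \<longleftrightarrow>
    (\<forall>s :: nat \<Rightarrow> _. (\<forall>e>0. \<exists>N. \<forall>i\<ge>N. \<forall>j\<ge>N. nrm (s i - s j) < e) \<longrightarrow>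
      (\<exists>l. (\<lambda>i. nrm (s i - l)) \<longlonglongrightarrow> 0))"
proof -
  interpret Metric_space UNIV "\<lambda>x y. nrm (x - y)" by (rule Metric_space_nrm)
  show ?thesis
    unfolding norm_complete_def mcomplete_def MCauchy_def limitin_metric_dist_null
    by (simp; meson)
qed

lemma limit_unique:
  fixes s :: "nat \<Rightarrow> 'a"
  assumes "(\<lambda>i. nrm (s i - l)) \<longlonglongrightarrow> 0" "(\<lambda>i. nrm (s i - m)) \<longlonglongrightarrow> 0"
  shows "l = m"
proof -
  have "(\<lambda>i. nrm (s i - l) + nrm (s i - m)) \<longlonglongrightarrow> 0"
    using tendsto_add[OF assms] by simp
  moreover have "nrm (l - m) \<le> nrm (s i - l) + nrm (s i - m)" for i
    using nrm_triangle_sub[of l m "s i"] by (simp add: nrm_diff_commute[of l])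
  ultimately have "nrm (l - m) \<le> 0"
    by (intro LIMSEQ_le_const) auto
  then show ?thesis
    using nrm_nonneg[of "l - m"] norm_eq_zero_iff[of "l - m"] by simp
qed

end

lemma complex_norm_cmod: "complex_norm cmod"
  by unfold_locales (auto simp: scaleC_complex_def norm_mult norm_triangle_ineq)

lemma norm_topology_cmod: "norm_topology cmod = euclidean"
  by (simp add: norm_topology_def flip: dist_norm)

lemma continuous_map_norm_iff:
  assumes "complex_norm n" "complex_norm m"
  shows "continuous_map (norm_topology n) (norm_topology m) f \<longleftrightarrow>
    (\<forall>a. \<forall>e>0. \<exists>d>0. \<forall>b. n (a - b) < d \<longrightarrow> m (f a - f b) < e)"
  unfolding norm_topology_def
  by (subst Metric_space.metric_continuous_map[OF complex_norm.Metric_space_nrm[OF assms(1)]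
        complex_norm.Metric_space_nrm[OF assms(2)]]) auto

text \<open>Linearity is left out on purpose: the criterion is also applied to constants (with
  \<open>K = 0\<close>), to the norm itself, and to extended maps whose linearity is not yet
  known.\<close>

lemma continuous_map_norm_Lipschitz:
  assumes n: "complex_norm n" and m: "complex_norm m" and K: "\<And>a b. m (f a - f b) \<le> K * n (a - b)"
  shows "continuous_map (norm_topology n) (norm_topology m) f"
  unfolding continuous_map_norm_iff[OF n m]
proof (intro allI impI)
  interpret n: complex_norm n by (rule n)
  fix a and e :: real assume "0 < e"
  \<comment> \<open>The sign of \<open>K\<close> is unspecified and \<open>K\<close> may be 0;
    \<open>\<bar>K\<bar> + 1\<close> is a positive Lipschitz constant in every case.\<close>
  have "m (f a - f b) < e" if "n (a - b) < e / (\<bar>K\<bar> + 1)" for b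
  proof -
    have "m (f a - f b) \<le> \<bar>K\<bar> * n (a - b)"
      using K[of a b] mult_right_mono[OF abs_ge_self n.nrm_nonneg[of "a - b"]] by (rule order_trans)
    also have "\<dots> \<le> (\<bar>K\<bar> + 1) * n (a - b)" by (simp add: mult_right_mono)
    also have "\<dots> < e" using that by (simp add: field_simps)
    finally show ?thesis .
  qed
  then show "\<exists>d>0. \<forall>b. n (a - b) < d \<longrightarrow> m (f a - f b) < e"
    using \<open>0 < e\<close> by (intro exI[of _ "e / (\<bar>K\<bar> + 1)"]) auto
qed

text \<open>The bound is asked to be strictly positive so that later arguments may divide by
  it.\<close>

lemma clinear_continuous_iff_bounded:
  assumes n: "complex_norm n" and m: "complex_norm m" and f: "clinear f"
  shows "continuous_map (norm_topology n) (norm_topology m) f \<longleftrightarrow> (\<exists>K>0. \<forall>a. m (f a) \<le> K * n a)"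
proof
  interpret n: complex_norm n by (rule n)
  interpret m: complex_norm m by (rule m)
  have f0: "f 0 = 0" and fs: "f (c *\<^sub>C a) = c *\<^sub>C f a" for c a
    using f complex_vector.linear_0[OF f] by (auto simp: clinear_iff)
  assume "continuous_map (norm_topology n) (norm_topology m) f"
  then have "\<exists>d>0. \<forall>b. n (0 - b) < d \<longrightarrow> m (f 0 - f b) < 1"
    unfolding continuous_map_norm_iff[OF n m] using zero_less_one by blast
  then obtain d where d: "d > 0" "\<And>b. n b < d \<Longrightarrow> m (f b) < 1"
    by (auto simp: f0)
  have "m (f a) \<le> (2 / d) * n a" for a
  proof (cases "a = 0")
    case False
    then have pos: "n a > 0" by (rule n.nrm_pos)
    \<comment> \<open>This factor rescales \<open>a\<close> to norm \<open>d / 2\<close>, strictly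
      inside the ball on which continuity at 0 gives the bound 1.\<close>
    let ?c = "complex_of_real (d / (2 * n a))"
    have "n (?c *\<^sub>C a) = d / 2" using pos d(1) by (simp add: n.norm_scale norm_divide norm_mult)
    then have "m (f (?c *\<^sub>C a)) < 1" using d by simp
    then have "d / (2 * n a) * m (f a) < 1"
      using pos d(1) by (simp add: fs m.norm_scale norm_divide norm_mult)
    then show ?thesis using pos d(1) by (simp add: field_simps)
  qed (simp add: f0)
  then show "\<exists>K>0. \<forall>a. m (f a) \<le> K * n a" using d(1) by (intro exI[of _ "2 / d"]) auto
next
  assume "\<exists>K>0. \<forall>a. m (f a) \<le> K * n a"
  then obtain K where "\<And>a. m (f a) \<le> K * n a" by blast
  then show "continuous_map (norm_topology n) (norm_topology m) f"
    by (intro continuous_map_norm_Lipschitz[OF n m, of f K])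
      (simp add: complex_vector.linear_diff[OF f, symmetric])
qed

lemma continuous_map_norm_add:
  assumes "complex_norm n" "complex_norm m"
    and "continuous_map (norm_topology n) (norm_topology m) f"
    and "continuous_map (norm_topology n) (norm_topology m) g"
  shows "continuous_map (norm_topology n) (norm_topology m) (\<lambda>a. f a + g a)"
  unfolding continuous_map_norm_iff[OF assms(1,2)]
proof (intro allI impI)
  interpret m: complex_norm m by (rule assms)
  fix a and e :: real assume "0 < e"
  then have e: "0 < e / 2" by simp
  obtain d where d: "d > 0" "\<And>b. n (a - b) < d \<Longrightarrow> m (f a - f b) < e / 2"
    using assms(3) e unfolding continuous_map_norm_iff[OF assms(1,2)] by meson
  obtain d' where d': "d' > 0" "\<And>b. n (a - b) < d' \<Longrightarrow> m (g a - g b) < e / 2"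
    using assms(4) e unfolding continuous_map_norm_iff[OF assms(1,2)] by meson
  have "m (f a + g a - (f b + g b)) < e" if "n (a - b) < min d d'" for b
    using m.norm_triangle[of "f a - f b" "g a - g b"] d(2)[of b] d'(2)[of b] that
    by (simp add: algebra_simps)
  then show "\<exists>d>0. \<forall>b. n (a - b) < d \<longrightarrow> m (f a + g a - (f b + g b)) < e"
    using d(1) d'(1) by (intro exI[of _ "min d d'"]) auto
qed

lemma continuous_map_norm_scale:
  assumes "complex_norm n"
  shows "continuous_map (norm_topology n) (norm_topology n) (\<lambda>a. c *\<^sub>C a)"
  by (rule continuous_map_norm_Lipschitz[OF assms assms, of _ "cmod c"])
    (simp add: complex_norm.norm_scale[OF assms] flip: complex_vector.scale_right_diff_distrib)

text \<open>The target is metric, hence Hausdorff, so the set where two continuous maps agree is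
  closed. This is what carries the algebraic identities to the completion.\<close>

lemma continuous_map_eq_on_dense:
  assumes "complex_norm n" "complex_norm m"
    and "continuous_map (norm_topology n) (norm_topology m) f"
    and "continuous_map (norm_topology n) (norm_topology m) g"
    and dense: "norm_topology n closure_of S = UNIV"
    and "\<And>v. v \<in> S \<Longrightarrow> f v = g v"
  shows "f u = g u"
proof (rule forall_in_closure_of_eq[of _ "norm_topology n" S "norm_topology m"])
  show "Hausdorff_space (norm_topology m)"
    unfolding norm_topology_def
    by (intro Metric_space.Hausdorff_space_mtopology complex_norm.Metric_space_nrm assms)
qed (use assms in auto)


section \<open>Separation of points by bounded functionals\<close>

text \<open>Every minimal sublinear functional is linear, so Zorn's lemma yields a Hahn--Banach theorem.\<close>

definition sublinear :: "('a::complex_vector \<Rightarrow> real) \<Rightarrow> bool"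
  where "sublinear q \<longleftrightarrow> (\<forall>x y. q (x + y) \<le> q x + q y) \<and>
    (\<forall>t\<ge>0. \<forall>x. q (complex_of_real t *\<^sub>C x) = t * q x)"

text \<open>One inequality for positive factors suffices: using it for \<open>1 / t\<close> at the
  point \<open>t x\<close> gives the reverse one.\<close>

lemma sublinearI:
  assumes "\<And>x y. q (x + y) \<le> q x + q y"
    and "q 0 = 0"
    and "\<And>t x. 0 < t \<Longrightarrow> q (complex_of_real t *\<^sub>C x) \<le> t * q x"
  shows "sublinear q"
  unfolding sublinear_def
proof (intro conjI allI impI assms(1))
  fix t :: real and x assume "0 \<le> t"
  show "q (complex_of_real t *\<^sub>C x) = t * q x"
  proof (cases "t = 0")
    case False
    with \<open>0 \<le> t\<close> have t: "0 < t" by simp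
    have "q (complex_of_real (1 / t) *\<^sub>C (complex_of_real t *\<^sub>C x))
        \<le> 1 / t * q (complex_of_real t *\<^sub>C x)"
      using t by (intro assms(3)) simp
    then have "t * q x \<le> q (complex_of_real t *\<^sub>C x)"
      using t by (simp add: scaleC_scaleC scaleC_one field_simps flip: of_real_mult)
    then show ?thesis using assms(3)[OF t, of x] by simp
  qed (simp add: assms(2))
qed

lemma sublinear_neg_le:
  assumes "sublinear q" shows "- q (- x) \<le> q x"
proof -
  have "q 0 = 0" using assms unfolding sublinear_def
    by (metis complex_vector.scale_zero_right mult_zero_left order_refl)
  moreover have "q (x + - x) \<le> q x + q (- x)" using assms unfolding sublinear_def by blast
  ultimately show ?thesis by simp
qed

text \<open>Common core of two constructions: the descent along a ray, where the index
  \<open>k\<close> is a sum or a product of parameters, and the infimum of a chain, where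
  \<open>k\<close> is the smaller of two functionals.\<close>

lemma sublinear_Inf:
  assumes I: "I \<noteq> {}" and bdd: "\<And>x. bdd_below ((\<lambda>i. F i x) ` I)"
    and zero: "\<And>i. i \<in> I \<Longrightarrow> F i 0 \<ge> 0" "\<exists>i\<in>I. F i 0 = 0"
    and add: "\<And>i j x y. i \<in> I \<Longrightarrow> j \<in> I \<Longrightarrow> \<exists>k\<in>I. F k (x + y) \<le> F i x + F j y"
    and scale: "\<And>i t x. i \<in> I \<Longrightarrow> 0 < t \<Longrightarrow> \<exists>k\<in>I. F k (complex_of_real t *\<^sub>C x) \<le> t * F i x"
  shows "sublinear (\<lambda>x. INF i\<in>I. F i x)"
proof (rule sublinearI)
  fix x y
  have "(INF k\<in>I. F k (x + y)) - F j y \<le> F i x" if ij: "i \<in> I" "j \<in> I" for i j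
  proof -
    obtain k where "k \<in> I" "F k (x + y) \<le> F i x + F j y" using add[OF ij] by blast
    with cINF_lower[OF bdd this(1), of "x + y"] show ?thesis by simp
  qed
  then have "(INF k\<in>I. F k (x + y)) - F j y \<le> (INF i\<in>I. F i x)" if "j \<in> I" for j
    using that by (intro cINF_greatest I)
  then have "(INF k\<in>I. F k (x + y)) - (INF i\<in>I. F i x) \<le> (INF j\<in>I. F j y)"
    by (intro cINF_greatest I) (simp add: algebra_simps)
  then show "(INF k\<in>I. F k (x + y)) \<le> (INF i\<in>I. F i x) + (INF j\<in>I. F j y)" by simp
next
  obtain i where "i \<in> I" "F i 0 = 0" using zero(2) by blast
  then have "(INF i\<in>I. F i 0) \<le> 0" using cINF_lower[OF bdd, of i 0] by simp
  moreover have "0 \<le> (INF i\<in>I. F i 0)" using zero(1) by (intro cINF_greatest I)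
  ultimately show "(INF i\<in>I. F i 0) = 0" by simp
next
  fix t :: real and x assume t: "0 < t"
  have "(INF k\<in>I. F k (complex_of_real t *\<^sub>C x)) / t \<le> F i x" if i: "i \<in> I" for i
  proof -
    obtain k where "k \<in> I" "F k (complex_of_real t *\<^sub>C x) \<le> t * F i x"
      using scale[OF i t] by blast
    with cINF_lower[OF bdd this(1), of "complex_of_real t *\<^sub>C x"] t show ?thesis
      by (simp add: field_simps)
  qed
  then have "(INF k\<in>I. F k (complex_of_real t *\<^sub>C x)) / t \<le> (INF i\<in>I. F i x)"
    by (intro cINF_greatest I)
  then show "(INF k\<in>I. F k (complex_of_real t *\<^sub>C x)) \<le> t * (INF i\<in>I. F i x)"
    using t by (simp add: field_simps)
qed

text \<open>The functional is \<open>q' x = inf {q (x + t a) - t q a | t >= 0}\<close>;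
  \<open>t = 0\<close> and \<open>t = 1\<close> give the two inequalities. For minimal
  \<open>q\<close> it coincides with \<open>q\<close>, and the last inequality becomes the converse
  of subadditivity.\<close>

lemma sublinear_descent:
  assumes q: "sublinear q"
  obtains q' where "sublinear q'" "\<And>x. q' x \<le> q x" "\<And>x. q' x + q a \<le> q (x + a)"
proof -
  have q_add: "q (x + y) \<le> q x + q y" and q_scale: "0 \<le> t \<Longrightarrow> q (complex_of_real t *\<^sub>C x) = t * q x"
    for x y t using q by (auto simp: sublinear_def)
  have q0: "q 0 = 0" using q_scale[of 0 0] by simp
  let ?F = "\<lambda>t x. q (x + complex_of_real t *\<^sub>C a) - t * q a"
  let ?q = "\<lambda>x. INF t\<in>{0..}. ?F t x"
  \<comment> \<open>Without this bound, uniform in \<open>t\<close>, the infimum could fail to be a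
    genuine one.\<close>
  have low: "- q (- x) \<le> ?F t x" if "0 \<le> t" for t x
    using q_add[of "x + complex_of_real t *\<^sub>C a" "- x"] q_scale[OF that, of a] by simp
  have bdd: "bdd_below ((\<lambda>t. ?F t x) ` {0..})" for x
    by (rule bdd_belowI2[of _ "- q (- x)"]) (simp add: low)
  have le: "?q x \<le> ?F t x" if "0 \<le> t" for t x
    using that by (intro cINF_lower bdd) simp
  have "sublinear ?q"
  proof (rule sublinear_Inf)
    fix s t :: real and x y assume "s \<in> {0..}" "t \<in> {0..}"
    moreover have "?F (s + t) (x + y) \<le> ?F s x + ?F t y"
      using q_add[of "x + complex_of_real s *\<^sub>C a" "y + complex_of_real t *\<^sub>C a"]
      by (simp add: algebra_simps scaleC_add_left)
    ultimately show "\<exists>r\<in>{0..}. ?F r (x + y) \<le> ?F s x + ?F t y" by (intro bexI[of _ "s + t"]) auto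
  next
    fix s t :: real and x assume st: "s \<in> {0..}" "0 < t"
    have "?F (t * s) (complex_of_real t *\<^sub>C x) = t * ?F s x"
      using q_scale[of t "x + complex_of_real s *\<^sub>C a"] st
      by (simp add: scaleC_add_right scaleC_scaleC algebra_simps)
    with st show "\<exists>r\<in>{0..}. ?F r (complex_of_real t *\<^sub>C x) \<le> t * ?F s x"
      by (intro bexI[of _ "t * s"]) auto
  next
    show "\<exists>t\<in>{0..}. ?F t 0 = 0" by (intro bexI[of _ 0]) (auto simp: q0)
  qed (use bdd q_scale in auto)
  moreover have "?q x \<le> q x" for x using le[of 0 x] by simp
  moreover have "?q x + q a \<le> q (x + a)" for x using le[of 1 x] by (simp add: scaleC_one)
  ultimately show thesis by (rule that)
qed

text \<open>Chains are bounded below by their pointwise infimum, which is finite because every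
  \<open>q \<le> p\<close> satisfies \<open>- p (- x) \<le> - q (- x) \<le> q x\<close>.\<close>

lemma sublinear_minimal_exists:
  fixes p :: "'a::complex_vector \<Rightarrow> real"
  assumes p: "sublinear p"
  obtains q where "sublinear q" "q \<le> p" "\<And>q'. sublinear q' \<Longrightarrow> q' \<le> q \<Longrightarrow> q' = q"
proof -
  let ?S = "{q. sublinear q \<and> q \<le> p}"
  \<comment> \<open>The order is reversed, so that the maximal element delivered by Zorn's lemma is
    a minimal functional.\<close>
  let ?R = "\<lambda>q q'. q' \<le> (q :: 'a \<Rightarrow> real)"
  have "\<exists>m\<in>?S. \<forall>q\<in>?S. ?R m q \<longrightarrow> q = m"
  proof (rule predicate_Zorn)
    show "partial_order_on ?S (relation_of ?R ?S)"
      by (auto simp: partial_order_on_def preorder_on_def refl_on_def trans_def antisym_def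
          relation_of_def)
  next
    fix C assume C: "C \<in> Chains (relation_of ?R ?S)"
    show "\<exists>u\<in>?S. \<forall>q\<in>C. ?R q u"
    proof (cases "C = {}")
      case True
      then show ?thesis using p by blast
    next
      case False
      have CS: "sublinear q" "q \<le> p" if "q \<in> C" for q
        using C that by (auto simp: Chains_def relation_of_def)
      have tot: "q \<le> q' \<or> q' \<le> q" if "q \<in> C" "q' \<in> C" for q q'
        using C that by (auto simp: Chains_def relation_of_def)
      have bdd: "bdd_below ((\<lambda>q. q x) ` C)" for x
      proof (rule bdd_belowI2[of _ "- p (- x)"])
        fix q assume "q \<in> C"
        then show "- p (- x) \<le> q x"
          using CS[of q] sublinear_neg_le[of q x] le_funD[of q p "- x"] by linarith
      qed
      have "sublinear (\<lambda>x. INF q\<in>C. q x)"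
      proof (rule sublinear_Inf[OF False bdd])
        show zero: "0 \<le> q 0" if "q \<in> C" for q
          using CS(1)[OF that] unfolding sublinear_def
          by (metis complex_vector.scale_zero_right mult_zero_left order_refl)
        show "\<exists>q\<in>C. q 0 = 0"
          using CS(1) False unfolding sublinear_def
          by (metis complex_vector.scale_zero_right mult_zero_left order_refl ex_in_conv)
        show "\<exists>k\<in>C. k (x + y) \<le> q x + q' y" if "q \<in> C" "q' \<in> C" for q q' x y
        proof (cases "q \<le> q'")
          case True
          then have "q (x + y) \<le> q x + q' y"
            using CS(1)[OF that(1)] le_funD[OF True, of y] unfolding sublinear_def
            by (meson add_left_mono order_trans)
          with that show ?thesis by blast
        next
          case False
          then have "q' \<le> q" using tot[OF that] by blast
          then have "q' (x + y) \<le> q x + q' y"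
            using CS(1)[OF that(2)] le_funD[OF \<open>q' \<le> q\<close>, of x] unfolding sublinear_def
            by (meson add_right_mono order_trans)
          with that show ?thesis by blast
        qed
        show "\<exists>k\<in>C. k (complex_of_real t *\<^sub>C x) \<le> t * q x" if "q \<in> C" "0 < t" for q t x
          using CS(1)[OF that(1)] that unfolding sublinear_def
          by (intro bexI[of _ q]) auto
      qed
      moreover have le: "(\<lambda>x. INF q\<in>C. q x) \<le> q" if "q \<in> C" for q
        using that by (intro le_funI cINF_lower bdd)
      ultimately show ?thesis using False CS by (intro bexI[of _ "\<lambda>x. INF q\<in>C. q x"]) (auto intro: order_trans)
    qed
  qed
  then obtain m where m: "m \<in> ?S" "\<And>q. q \<in> ?S \<Longrightarrow> q \<le> m \<Longrightarrow> q = m" by blast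
  show thesis
  proof (rule that[of m])
    show "q' = m" if "sublinear q'" "q' \<le> m" for q'
      using m that by (auto intro: order_trans)
  qed (use m(1) in auto)
qed

text \<open>Before minimizing, \<open>p\<close> is lowered once in the direction \<open>a\<close>.
  At \<open>- a\<close> the lowered functional is at most \<open>p 0 - p a = - p a\<close>, and this
  bound survives in the minimal \<open>q\<close> and fixes its value there.\<close>

lemma sublinear_dominates_linear:
  fixes p :: "'a::complex_vector \<Rightarrow> real"
  assumes p: "sublinear p"
  obtains q where "\<And>x. q x \<le> p x" "\<And>x y. q (x + y) = q x + q y"
    "\<And>t x. q (complex_of_real t *\<^sub>C x) = t * q x" "q (- a) = - p a"
proof -
  obtain p' where p': "sublinear p'" "\<And>x. p' x \<le> p x" "\<And>x. p' x + p a \<le> p (x + a)"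
    using sublinear_descent[OF p, of a] by metis
  obtain q where q: "sublinear q" "q \<le> p'" "\<And>q'. sublinear q' \<Longrightarrow> q' \<le> q \<Longrightarrow> q' = q"
    using sublinear_minimal_exists[OF p'(1)] by metis
  have q_scale: "0 \<le> t \<Longrightarrow> q (complex_of_real t *\<^sub>C x) = t * q x" for t x
    using q(1) by (auto simp: sublinear_def)
  have q0: "q 0 = 0" using q_scale[of 0 0] by simp
  have add: "q (x + y) = q x + q y" for x y
  proof -
    obtain q' where q': "sublinear q'" "\<And>x. q' x \<le> q x" "\<And>x. q' x + q y \<le> q (x + y)"
      using sublinear_descent[OF q(1), of y] by metis
    \<comment> \<open>Minimality of \<open>q\<close> forbids the descent along \<open>y\<close> from
      lowering it any further.\<close>
    have "q' = q" using q' by (intro q(3)) (auto simp: le_fun_def)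
    with q'(3)[of x] q(1) show ?thesis by (auto simp: sublinear_def intro: antisym)
  qed
  have neg: "q (- x) = - q x" for x using add[of x "- x"] q0 by simp
  have scale: "q (complex_of_real t *\<^sub>C x) = t * q x" for t x
  proof (cases "0 \<le> t")
    case False
    then show ?thesis using q_scale[of "- t" x] neg by simp
  qed (rule q_scale)
  have p0: "p 0 = 0" using p unfolding sublinear_def
    by (metis complex_vector.scale_zero_right mult_zero_left order_refl)
  have qp: "q x \<le> p x" for x using le_funD[OF q(2), of x] p'(2)[of x] by linarith
  have "q (- a) \<le> - p a" using le_funD[OF q(2), of "- a"] p'(3)[of "- a"] p0 by simp
  moreover have "- p a \<le> q (- a)" using qp[of a] by (simp add: neg)
  ultimately have "q (- a) = - p a" by simp
  with qp add scale show thesis by (rule that)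
qed

section \<open>The unit ball of the topological dual\<close>

text \<open>A pointwise inequality replaces continuity and the operator norm, so that no supremum
  has to be handled once \<open>dual_ball_iff\<close> is available.\<close>

definition dual_ball :: "('a::complex_vector \<Rightarrow> real) \<Rightarrow> ('a \<Rightarrow> complex) set"
  where "dual_ball n = {f. clinear f \<and> (\<forall>a. cmod (f a) \<le> n a)}"

lemma dual_ball_iff:
  assumes n: "complex_norm n"
  shows "f \<in> topological_dual n \<and> dual_norm n f \<le> 1 \<longleftrightarrow> f \<in> dual_ball n"
proof (cases "clinear f")
  case f: True
  interpret n: complex_norm n by (rule n)
  have fs: "f (c *\<^sub>C a) = c * f a" for c a using f by (auto simp: clinear_iff scaleC_complex_def)
  note iff = clinear_continuous_iff_bounded[OF n complex_norm_cmod f, unfolded norm_topology_cmod]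
  let ?S = "{cmod (f a) |a. n a \<le> 1}"
  have ne: "?S \<noteq> {}" using n.nrm_zero by (metis (mono_tags, lifting) empty_iff mem_Collect_eq zero_le_one)
  show ?thesis
  proof
    assume L: "f \<in> topological_dual n \<and> dual_norm n f \<le> 1"
    then obtain K where K: "K > 0" "\<And>a. cmod (f a) \<le> K * n a"
      using iff by (auto simp: topological_dual_def)
    have "cmod (f a) \<le> K" if "n a \<le> 1" for a
      using K(2)[of a] mult_left_mono[OF that, of K] K(1) by linarith
    \<comment> \<open>Continuity has to be used first: \<open>dual_norm\<close> is a real
      \<open>Sup\<close>, and the assumption that it is at most 1 says something about the values
      only if the set is bounded.\<close>
    then have "bdd_above ?S" by (intro bdd_aboveI[of _ K]) auto
    then have le1: "cmod (f a) \<le> 1" if "n a \<le> 1" for a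
      using L that cSup_upper[of "cmod (f a)" ?S] by (force simp: dual_norm_def)
    have "cmod (f a) \<le> n a" for a
    proof (cases "a = 0")
      case True
      then show ?thesis using K(2)[of a] by simp
    next
      case False
      then have pos: "n a > 0" by (rule n.nrm_pos)
      show ?thesis
        using le1[of "complex_of_real (1 / n a) *\<^sub>C a"] pos
        by (simp add: n.norm_scale fs norm_mult norm_divide field_simps)
    qed
    with f show "f \<in> dual_ball n" by (simp add: dual_ball_def)
  next
    assume "f \<in> dual_ball n"
    then have le: "\<And>a. cmod (f a) \<le> n a" by (simp add: dual_ball_def)
    then have "dual_norm n f \<le> 1"
      unfolding dual_norm_def by (intro cSup_least ne) (auto intro: order_trans)
    moreover have "f \<in> topological_dual n"
      using f iff le by (auto simp: topological_dual_def intro!: exI[of _ 1])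
    ultimately show "f \<in> topological_dual n \<and> dual_norm n f \<le> 1" by simp
  qed
qed (auto simp: topological_dual_def dual_ball_def)

text \<open>The real functional is dominated by half the norm. Its complexification has modulus at
  most the sum of two terms of size \<open>n x / 2\<close>, which gives the bound \<open>n x\<close>
  without a rotation argument.\<close>

lemma dual_ball_separates:
  assumes n: "complex_norm n" and a: "a \<noteq> 0"
  obtains f where "f \<in> dual_ball n" "f a \<noteq> 0"
proof -
  interpret n: complex_norm n by (rule n)
  have "sublinear (\<lambda>x. n x / 2)"
    by (rule sublinearI) (use n.norm_triangle in \<open>auto simp: n.norm_scale add_divide_distrib[symmetric]
        intro: divide_right_mono\<close>)
  then obtain q where q: "\<And>x. q x \<le> n x / 2" "\<And>x y. q (x + y) = q x + q y"
    "\<And>t x. q (complex_of_real t *\<^sub>C x) = t * q x" "q (- a) = - (n a / 2)"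
    by (rule sublinear_dominates_linear[of "\<lambda>x. n x / 2" a]) (rule that; assumption)
  have neg: "q (- x) = - q x" for x using q(3)[of "-1" x] by (simp add: scaleC_one)
  have abs: "\<bar>q x\<bar> \<le> n x / 2" for x using q(1)[of x] q(1)[of "- x"] by (simp add: neg)
  \<comment> \<open>The usual complexification \<open>q x - i q (i x)\<close> of a real-linear
    functional.\<close>
  define f where "f x = Complex (q x) (- q (\<i> *\<^sub>C x))" for x
  have "f (x + y) = f x + f y" for x y
    by (simp add: f_def q(2) scaleC_add_right complex_eq_iff)
  moreover have "f (c *\<^sub>C x) = c * f x" for c x
  proof -
    have split: "c *\<^sub>C x = complex_of_real (Re c) *\<^sub>C x + complex_of_real (Im c) *\<^sub>C (\<i> *\<^sub>C x)" for c x
      by (simp add: scaleC_scaleC scaleC_add_left[symmetric] mult.commute flip: complex_eq)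
    have "q (c *\<^sub>C x) = Re c * q x + Im c * q (\<i> *\<^sub>C x)" for c x
      by (subst split) (simp only: q)
    \<comment> \<open>The first instance is the real part of the claim, the one for
      \<open>\<i> * c\<close> the imaginary part.\<close>
    from this[of c x] this[of "\<i> * c" x] show ?thesis
      by (simp add: f_def scaleC_scaleC complex_eq_iff)
  qed
  ultimately have "clinear f" by (simp add: clinear_iff scaleC_complex_def)
  moreover have "cmod (f x) \<le> n x" for x
    using cmod_le[of "f x"] abs[of x] abs[of "\<i> *\<^sub>C x"] by (simp add: f_def n.norm_scale)
  moreover have "f a \<noteq> 0" using q(4) n.nrm_pos[OF a] by (simp add: f_def complex_eq_iff neg)
  ultimately show thesis by (intro that[of f]) (auto simp: dual_ball_def)
qed

section \<open>Sums of elementary tensors\<close>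

lemma tensor_sum_Nil [simp]: "tensor_sum [] = 0"
  by (simp add: tensor_sum_def)

lemma tensor_sum_Cons [simp]: "tensor_sum ((a, b) # r) = a \<otimes> b + tensor_sum r"
  by (simp add: tensor_sum_def)

lemma tensor_sum_append [simp]: "tensor_sum (r @ s) = tensor_sum r + tensor_sum s"
  by (simp add: tensor_sum_def)

lemma tensor_zero_left [simp]: "0 \<otimes> b = 0"
  using tensor_scale_left[of 0 0 b] by simp

lemma tensor_zero_right [simp]: "a \<otimes> 0 = 0"
  using tensor_scale_right[of a 0 0] by simp

lemma tensor_diff_left: "(a - a') \<otimes> b = a \<otimes> b - a' \<otimes> b"
  using tensor_add_left[of "a - a'" a' b] by simp

lemma tensor_diff_right: "a \<otimes> (b - b') = a \<otimes> b - a \<otimes> b'"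
  using tensor_add_right[of a "b - b'" b'] by simp

lemma sum_list_pair_add:
  fixes f g :: "'x \<Rightarrow> 'y \<Rightarrow> 'z::ab_group_add"
  shows "(\<Sum>(x, y)\<leftarrow>s. f x y + g x y) = (\<Sum>(x, y)\<leftarrow>s. f x y) + (\<Sum>(x, y)\<leftarrow>s. g x y)"
  by (induction s) (auto simp: algebra_simps)

lemma sum_list_pair_scaleC:
  fixes f :: "'x \<Rightarrow> 'y \<Rightarrow> 'z::complex_vector"
  shows "(\<Sum>(x, y)\<leftarrow>s. c *\<^sub>C f x y) = c *\<^sub>C (\<Sum>(x, y)\<leftarrow>s. f x y)"
  by (induction s) (auto simp: scaleC_add_right)

abbreviation scale_fst :: "complex \<Rightarrow> ('a::complex_vector \<times> 'b) list \<Rightarrow> ('a \<times> 'b) list"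
  where "scale_fst c r \<equiv> map (\<lambda>(a, b). (c *\<^sub>C a, b)) r"

lemma tensor_sum_scale_fst: "tensor_sum (scale_fst c r) = c *\<^sub>C tensor_sum r"
  by (induction r) (auto simp: tensor_scale_left scaleC_add_right)

text \<open>Coefficients of a formal combination are absorbed into the first factors. The induction
  runs over a finite set containing the keys, from which one key is removed by subtraction.\<close>

lemma tensor_sum_surj:
  obtains r where "z = tensor_sum r"
proof -
  have "\<exists>r. abs_tensor p = tensor_sum r" if "finite K" "Poly_Mapping.keys p \<subseteq> K" for K and p :: "'a \<times> 'b \<Rightarrow>\<^sub>0 complex"
    using that
  proof (induction K arbitrary: p)
    case empty
    then have "p = 0" by simp
    then have "abs_tensor p = tensor_sum []" by (simp add: zero_tensor.abs_eq)
    then show ?case by blast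
  next
    case (insert k K)
    obtain a b where k: "k = (a, b)" by (cases k)
    let ?c = "Poly_Mapping.lookup p k"
    let ?q = "p - Poly_Mapping.single k ?c"
    have "Poly_Mapping.keys ?q \<subseteq> K"
      using insert.prems by (auto simp: in_keys_iff lookup_minus lookup_single when_def split: if_splits)
    then obtain r where r: "abs_tensor ?q = tensor_sum r" using insert.IH by blast
    have "abs_tensor p = abs_tensor (?c *\<^sub>C Poly_Mapping.single k 1 + ?q)"
      by (simp add: scaleC_single scaleC_complex_def)
    also have "\<dots> = tensor_sum (((?c *\<^sub>C a), b) # r)"
      by (simp only: plus_tensor.abs_eq[symmetric] scaleC_tensor.abs_eq[symmetric] r tensor_sum_Cons
          tensor_scale_left)
        (simp only: k tensor_elem.abs_eq)
    finally show ?case by blast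
  qed
  then have "\<exists>r. abs_tensor p = tensor_sum r" for p :: "'a \<times> 'b \<Rightarrow>\<^sub>0 complex"
    using finite_keys by blast
  then have "\<exists>r. z = tensor_sum r" by (induction z rule: tensor.abs_induct)
  then show thesis using that by blast
qed

text \<open>Additive induction is enough: a scalar multiple of \<open>a \<otimes> b\<close> is again
  elementary, and 0 is \<open>0 \<otimes> 0\<close>.\<close>

lemma tensor_induct [case_names elem add]:
  assumes "\<And>a b. P (a \<otimes> b)" and "\<And>z w. P z \<Longrightarrow> P w \<Longrightarrow> P (z + w)"
  shows "P z"
proof -
  obtain r where z: "z = tensor_sum r" by (rule tensor_sum_surj)
  show ?thesis unfolding z
  proof (induction r)
    case Nil
    then show ?case using assms(1)[of 0 0] by simp
  qed (use assms in auto)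
qed

text \<open>Links the span to the side condition \<open>set r \<subseteq> A0 \<times> B0\<close>
  under which \<open>tensor_mult\<close> can be evaluated.\<close>

lemma tensor_subspace_iff:
  assumes A0: "complex_vector.subspace A0"
  shows "z \<in> tensor_subspace A0 B0 \<longleftrightarrow> (\<exists>r. set r \<subseteq> A0 \<times> B0 \<and> z = tensor_sum r)"
proof
  assume "z \<in> tensor_subspace A0 B0"
  then show "\<exists>r. set r \<subseteq> A0 \<times> B0 \<and> z = tensor_sum r"
    unfolding tensor_subspace_def
  proof (induction rule: complex_vector.span_induct_alt)
    case base
    show ?case by (intro exI[of _ "[]"]) auto
  next
    case (step c v w)
    then obtain x y r where "v = x \<otimes> y" "x \<in> A0" "y \<in> B0" "set r \<subseteq> A0 \<times> B0" "w = tensor_sum r"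
      by blast
    then show ?case
      by (intro exI[of _ "(c *\<^sub>C x, y) # r"])
        (auto simp: tensor_scale_left complex_vector.subspace_scale[OF A0])
  qed
next
  have "tensor_sum r \<in> tensor_subspace A0 B0" if "set r \<subseteq> A0 \<times> B0" for r
    using that unfolding tensor_subspace_def
  proof (induction r)
    case (Cons p r)
    obtain x y where p: "p = (x, y)" by (cases p)
    with Cons.prems have "x \<otimes> y \<in> {x \<otimes> y |x y. x \<in> A0 \<and> y \<in> B0}" by auto
    with Cons show ?case
      by (simp add: p complex_vector.span_add complex_vector.span_base)
  qed (simp add: complex_vector.span_zero)
  then show "\<exists>r. set r \<subseteq> A0 \<times> B0 \<and> z = tensor_sum r \<Longrightarrow> z \<in> tensor_subspace A0 B0" by blast
qed

lemma tensor_subspace_induct [consumes 3, case_names elem add]: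
  assumes A0: "complex_vector.subspace A0" and B0: "complex_vector.subspace B0"
    and z: "z \<in> tensor_subspace A0 B0"
    and elem: "\<And>x y. x \<in> A0 \<Longrightarrow> y \<in> B0 \<Longrightarrow> P (x \<otimes> y)"
    and add: "\<And>z w. z \<in> tensor_subspace A0 B0 \<Longrightarrow> w \<in> tensor_subspace A0 B0 \<Longrightarrow> P z \<Longrightarrow> P w \<Longrightarrow>
      P (z + w)"
  shows "P z"
proof -
  obtain r where "set r \<subseteq> A0 \<times> B0" and z: "z = tensor_sum r"
    using z tensor_subspace_iff[OF A0] by blast
  then show ?thesis unfolding z
  proof (induction r)
    case Nil
    then show ?case
      using elem[of 0 0] complex_vector.subspace_0[OF A0] complex_vector.subspace_0[OF B0] by simp
  next
    case (Cons p r)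
    obtain x y where p: "p = (x, y)" by (cases p)
    with Cons.prems have xy: "x \<in> A0" "y \<in> B0" "set r \<subseteq> A0 \<times> B0" by auto
    have "set [(x, y)] \<subseteq> A0 \<times> B0" using xy by simp
    then have "tensor_sum [(x, y)] \<in> tensor_subspace A0 B0" "tensor_sum r \<in> tensor_subspace A0 B0"
      using xy(3) tensor_subspace_iff[OF A0] by blast+
    then show ?case using add[of "x \<otimes> y" "tensor_sum r"] elem xy Cons.IH by (simp add: p)
  qed
qed

section \<open>Cross norms compatible with linear and conjugate-linear maps\<close>

definition semilinear :: "(complex \<Rightarrow> complex) \<Rightarrow> ('a::complex_vector \<Rightarrow> 'b::complex_vector) \<Rightarrow> bool"
  where "semilinear \<sigma> R \<longleftrightarrow> (\<forall>x y. R (x + y) = R x + R y) \<and> (\<forall>c x. R (c *\<^sub>C x) = \<sigma> c *\<^sub>C R x)"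

text \<open>These are the only properties of the two norms that the algebraic part uses. The map
  \<open>R \<otimes> S\<close> is given by its effect on a representation, so that one condition
  covers linear and conjugate-linear pairs.\<close>

locale uniform_cross_norm = complex_norm \<alpha>
  for nA :: "'a::complex_vector \<Rightarrow> real" and nB :: "'b::complex_vector \<Rightarrow> real"
    and \<alpha> :: "('a, 'b) tensor \<Rightarrow> real" +
  assumes cross: "\<alpha> (a \<otimes> b) \<le> nA a * nB b"
    and uniform: "\<sigma> = id \<or> \<sigma> = cnj \<Longrightarrow> semilinear \<sigma> R \<Longrightarrow> semilinear \<sigma> S \<Longrightarrow> 0 < K \<Longrightarrow> 0 < L \<Longrightarrow>
      (\<And>a. nA (R a) \<le> K * nA a) \<Longrightarrow> (\<And>b. nB (S b) \<le> L * nB b) \<Longrightarrow>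
      \<alpha> (\<Sum>(a, b)\<leftarrow>r. R a \<otimes> S b) \<le> K * L * \<alpha> (tensor_sum r)"

lemma complex_normI:
  assumes zero: "n 0 = 0" and definite: "\<And>x. n x = 0 \<Longrightarrow> x = 0"
    and triangle: "\<And>x y. n (x + y) \<le> n x + n y"
    and scale: "\<And>c x. c \<noteq> 0 \<Longrightarrow> n (c *\<^sub>C x) \<le> cmod c * n x"
  shows "complex_norm n"
proof
  show "n (c *\<^sub>C x) = cmod c * n x" for c x
  proof (cases "c = 0")
    case False
    then have "n (inverse c *\<^sub>C (c *\<^sub>C x)) \<le> cmod (inverse c) * n (c *\<^sub>C x)" by (intro scale) simp
    then have "cmod c * n x \<le> n (c *\<^sub>C x)"
      using False by (simp add: scaleC_scaleC scaleC_one norm_inverse norm_divide field_simps)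
    with scale[OF False, of x] show ?thesis by simp
  qed (simp add: zero)
qed (use assms in auto)

lemma map_tensor_sum: "(\<Sum>(a, b)\<leftarrow>r. R a \<otimes> S b) = tensor_sum (map (\<lambda>(a, b). (R a, S b)) r)"
  by (induction r) auto

text \<open>Adding multiples of one vector \<open>a\<close> to all first components changes the
  tensor by a single elementary one; this removes a term from a representation in the proof of
  definiteness.\<close>

lemma tensor_sum_shear:
  "tensor_sum (map (\<lambda>(x, y). (x + c x *\<^sub>C a, y)) s) = tensor_sum s + a \<otimes> (\<Sum>(x, y)\<leftarrow>s. c x *\<^sub>C y)"
  by (induction s)
    (auto simp: tensor_add_left tensor_add_right tensor_scale_left tensor_scale_right)

lemma sum_list_map_pair:
  "(\<Sum>(a, b)\<leftarrow>map (\<lambda>(a, b). (R a, S b)) r. h a b) = (\<Sum>(a, b)\<leftarrow>r. h (R a) (S b))"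
  by (induction r) auto

section \<open>The injective norm\<close>

context
  fixes nA :: "'a::complex_vector \<Rightarrow> real" and nB :: "'b::complex_vector \<Rightarrow> real"
  assumes nA: "complex_norm nA" and nB: "complex_norm nB"
begin

interpretation A: complex_norm nA by (rule nA)
interpretation B: complex_norm nB by (rule nB)

text \<open>The map \<open>(a, b) \<mapsto> f a * g b\<close> is bilinear, so the universal property
  applies. It makes the supremum over all representations a supremum over pairs of functionals
  only.\<close>

lemma dual_pairing_well_defined:
  assumes f: "f \<in> dual_ball nA" and g: "g \<in> dual_ball nB" and eq: "tensor_sum r = tensor_sum s"
  shows "(\<Sum>(a, b)\<leftarrow>r. f a * g b) = (\<Sum>(a, b)\<leftarrow>s. f a * g b)"
  by (rule tensor_sum_well_defined[where \<sigma> = id, OF _ _ _ _ _ eq])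
    (use f g in \<open>auto simp: dual_ball_def clinear_iff scaleC_complex_def algebra_simps\<close>)

lemma injective_norm_eq:
  "injective_norm nA nB z = Sup {cmod (\<Sum>(a, b)\<leftarrow>r. f a * g b) |r f g. z = tensor_sum r \<and>
      f \<in> dual_ball nA \<and> g \<in> dual_ball nB}"
  unfolding injective_norm_def dual_ball_iff[OF nA, symmetric] dual_ball_iff[OF nB, symmetric]
  by (rule arg_cong[where f = Sup]) blast

lemma zero_in_dual_ball: "(\<lambda>_. 0) \<in> dual_ball nA" "(\<lambda>_. 0) \<in> dual_ball nB"
  by (auto simp: dual_ball_def clinear_iff)

text \<open>Used three times: for the finiteness of the supremum, for the cross inequality, and for
  the comparison with the projective norm.\<close>

lemma dual_pairing_bound:
  assumes "f \<in> dual_ball nA" "g \<in> dual_ball nB"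
  shows "cmod (\<Sum>(a, b)\<leftarrow>r. f a * g b) \<le> (\<Sum>(a, b)\<leftarrow>r. nA a * nB b)"
proof (induction r)
  case (Cons p r)
  obtain a b where p: "p = (a, b)" by (cases p)
  have "cmod (f a * g b) \<le> nA a * nB b"
    using assms by (auto simp: dual_ball_def norm_mult intro: mult_mono)
  with Cons show ?case
    using norm_triangle_ineq[of "f a * g b" "\<Sum>(a, b)\<leftarrow>r. f a * g b"] by (simp add: p)
qed simp

lemma injective_norm_upper:
  assumes f: "f \<in> dual_ball nA" and g: "g \<in> dual_ball nB"
  shows "cmod (\<Sum>(a, b)\<leftarrow>r. f a * g b) \<le> injective_norm nA nB (tensor_sum r)"
  unfolding injective_norm_eq
proof (rule cSup_upper)
  show "bdd_above {cmod (\<Sum>(a, b)\<leftarrow>s. f a * g b) |s f g. tensor_sum r = tensor_sum s \<and>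
      f \<in> dual_ball nA \<and> g \<in> dual_ball nB}"
  proof (rule bdd_aboveI[of _ "\<Sum>(a, b)\<leftarrow>r. nA a * nB b"], clarify)
    fix s f g assume "tensor_sum r = tensor_sum s" "f \<in> dual_ball nA" "g \<in> dual_ball nB"
    then show "cmod (\<Sum>(a, b)\<leftarrow>s. f a * g b) \<le> (\<Sum>(a, b)\<leftarrow>r. nA a * nB b)"
      using dual_pairing_bound[of f g r] dual_pairing_well_defined[of f g r s] by simp
  qed
qed (use f g in blast)

lemma injective_norm_least:
  assumes "\<And>f g. f \<in> dual_ball nA \<Longrightarrow> g \<in> dual_ball nB \<Longrightarrow> cmod (\<Sum>(a, b)\<leftarrow>r. f a * g b) \<le> c"
  shows "injective_norm nA nB (tensor_sum r) \<le> c"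
  unfolding injective_norm_eq
proof (rule cSup_least)
  show "{cmod (\<Sum>(a, b)\<leftarrow>s. f a * g b) |s f g. tensor_sum r = tensor_sum s \<and>
      f \<in> dual_ball nA \<and> g \<in> dual_ball nB} \<noteq> {}"
    using zero_in_dual_ball by blast
next
  fix x assume "x \<in> {cmod (\<Sum>(a, b)\<leftarrow>s. f a * g b) |s f g. tensor_sum r = tensor_sum s \<and>
      f \<in> dual_ball nA \<and> g \<in> dual_ball nB}"
  then obtain s f g where x: "x = cmod (\<Sum>(a, b)\<leftarrow>s. f a * g b)" "tensor_sum r = tensor_sum s"
    "f \<in> dual_ball nA" "g \<in> dual_ball nB" by blast
  then show "x \<le> c" using assms[of f g] dual_pairing_well_defined[of f g r s] by simp
qed

lemma tensor_sum_eq_0_if_slices_vanish: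
  assumes "\<And>f. f \<in> dual_ball nA \<Longrightarrow> (\<Sum>(a, b)\<leftarrow>r. f a *\<^sub>C b) = 0"
  shows "tensor_sum r = (0 :: ('a, 'b) tensor)"
  using assms
proof (induction "length r" arbitrary: r)
  case (Suc k)
  then obtain a b s where r: "r = (a, b) # s" "length s = k"
    by (metis length_Suc_conv surj_pair)
  show ?case
  \<comment> \<open>No functional detects \<open>a = 0\<close>, but then the first term vanishes and
    can simply be dropped.\<close>
  proof (cases "a = 0")
    case True
    have "f 0 = 0" if "f \<in> dual_ball nA" for f
      using that by (auto simp: dual_ball_def dest: complex_vector.linear_0)
    then have "tensor_sum s = 0"
      using Suc.prems by (intro Suc.hyps(1)) (force simp: r True)+
    then show ?thesis by (simp add: r True)
  next
    case False
    text \<open>A functional not vanishing at \<open>a\<close> expresses \<open>b\<close> by the second components of \<open>s\<close>, so that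
      the representation can be shortened.\<close>
    obtain f where f: "f \<in> dual_ball nA" "f a \<noteq> 0"
      by (rule dual_ball_separates[OF nA False])
    define c where "c x = - (f x / f a)" for x
    \<comment> \<open>Since \<open>b\<close> will be the sum of the \<open>c x *\<^sub>C y\<close>,
      distributing \<open>a \<otimes> b\<close> over the other terms gives \<open>?t\<close>: the
      same tensor and the same slices with one term less.\<close>
    let ?t = "map (\<lambda>(x, y). (x + c x *\<^sub>C a, y)) s"
    have "(\<Sum>(x, y)\<leftarrow>s. f a *\<^sub>C c x *\<^sub>C y) = (\<Sum>(x, y)\<leftarrow>s. (- 1) *\<^sub>C f x *\<^sub>C y)"
      using f(2) by (simp add: c_def scaleC_scaleC)
    also have "\<dots> = f a *\<^sub>C b"
    proof -
      have "(\<Sum>(x, y)\<leftarrow>s. f x *\<^sub>C y) = - (f a *\<^sub>C b)"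
        using Suc.prems[OF f(1)] by (simp add: r eq_neg_iff_add_eq_0 add.commute)
      then show ?thesis unfolding sum_list_pair_scaleC by (simp add: scaleC_one)
    qed
    finally have b: "(\<Sum>(x, y)\<leftarrow>s. c x *\<^sub>C y) = b"
      unfolding sum_list_pair_scaleC using f(2) by simp
    have "tensor_sum ?t = 0"
    proof (rule Suc.hyps(1))
      fix h assume h: "h \<in> dual_ball nA"
      have lin: "h (x + d *\<^sub>C a) = h x + d * h a" for d x
        using h by (auto simp: dual_ball_def clinear_iff scaleC_complex_def)
      have "(\<Sum>(x, y)\<leftarrow>?t. h x *\<^sub>C y) = (\<Sum>(x, y)\<leftarrow>s. h x *\<^sub>C y + h a *\<^sub>C c x *\<^sub>C y)"
        by (induction s) (auto simp: lin scaleC_add_left scaleC_scaleC mult.commute)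
      also have "\<dots> = (\<Sum>(x, y)\<leftarrow>s. h x *\<^sub>C y) + h a *\<^sub>C b"
        by (simp only: sum_list_pair_add sum_list_pair_scaleC b)
      also have "\<dots> = 0" using Suc.prems[OF h] by (simp add: r add.commute)
      finally show "(\<Sum>(x, y)\<leftarrow>?t. h x *\<^sub>C y) = 0" .
    qed (simp add: r)
    then show ?thesis by (simp add: r tensor_sum_shear b add.commute)
  qed
qed simp

text \<open>Separation is used once more, now in the second factor: a functional that sees a nonzero
  slice would give a nonzero pairing.\<close>

lemma injective_norm_definite:
  assumes "injective_norm nA nB z = 0" shows "z = 0"
proof -
  obtain r where z: "z = tensor_sum r" by (rule tensor_sum_surj)
  have "(\<Sum>(a, b)\<leftarrow>r. f a *\<^sub>C b) = 0" if f: "f \<in> dual_ball nA" for f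
  proof (rule ccontr)
    assume "(\<Sum>(a, b)\<leftarrow>r. f a *\<^sub>C b) \<noteq> 0"
    then obtain g where g: "g \<in> dual_ball nB" "g (\<Sum>(a, b)\<leftarrow>r. f a *\<^sub>C b) \<noteq> 0"
      by (rule dual_ball_separates[OF nB])
    have lin: "clinear g" using g(1) by (simp add: dual_ball_def)
    have "g (\<Sum>(a, b)\<leftarrow>r. f a *\<^sub>C b) = (\<Sum>(a, b)\<leftarrow>r. f a * g b)"
      using lin complex_vector.linear_0[OF lin]
      by (induction r) (auto simp: clinear_iff scaleC_complex_def)
    with g(2) injective_norm_upper[OF f g(1), of r] assms show False by (simp add: z)
  qed
  then show ?thesis unfolding z by (rule tensor_sum_eq_0_if_slices_vanish)
qed

lemma injective_norm_nonneg: "0 \<le> injective_norm nA nB z"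
proof -
  obtain r where z: "z = tensor_sum r" by (rule tensor_sum_surj)
  show ?thesis
    using injective_norm_upper[OF zero_in_dual_ball, of r] norm_ge_zero order_trans unfolding z by blast
qed

lemma complex_norm_injective_norm: "complex_norm (injective_norm nA nB)"
proof (rule complex_normI)
  have "injective_norm nA nB (tensor_sum []) \<le> 0" by (rule injective_norm_least) simp
  then show "injective_norm nA nB 0 = 0" using injective_norm_nonneg[of 0] by simp
next
  fix z w :: "('a, 'b) tensor"
  obtain r s where z: "z = tensor_sum r" "w = tensor_sum s" by (meson tensor_sum_surj)
  have "injective_norm nA nB (tensor_sum (r @ s)) \<le> injective_norm nA nB z + injective_norm nA nB w"
  proof (rule injective_norm_least)
    fix f g assume fg: "f \<in> dual_ball nA" "g \<in> dual_ball nB"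
    show "cmod (\<Sum>(a, b)\<leftarrow>r @ s. f a * g b) \<le> injective_norm nA nB z + injective_norm nA nB w"
      using norm_triangle_ineq[of "\<Sum>(a, b)\<leftarrow>r. f a * g b" "\<Sum>(a, b)\<leftarrow>s. f a * g b"]
        injective_norm_upper[OF fg, of r] injective_norm_upper[OF fg, of s] by (simp add: z)
  qed
  then show "injective_norm nA nB (z + w) \<le> injective_norm nA nB z + injective_norm nA nB w"
    by (simp add: z)
next
  fix c and z :: "('a, 'b) tensor"
  obtain r where z: "z = tensor_sum r" by (rule tensor_sum_surj)
  have "injective_norm nA nB (tensor_sum (scale_fst c r)) \<le> cmod c * injective_norm nA nB z"
  proof (rule injective_norm_least)
    fix f g assume fg: "f \<in> dual_ball nA" "g \<in> dual_ball nB"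
    have "(\<Sum>(a, b)\<leftarrow>scale_fst c r. f a * g b) = c * (\<Sum>(a, b)\<leftarrow>r. f a * g b)"
      using fg by (induction r) (auto simp: dual_ball_def clinear_iff scaleC_complex_def algebra_simps)
    then show "cmod (\<Sum>(a, b)\<leftarrow>scale_fst c r. f a * g b) \<le> cmod c * injective_norm nA nB z"
      using injective_norm_upper[OF fg, of r] by (simp add: z norm_mult mult_left_mono)
  qed
  then show "injective_norm nA nB (c *\<^sub>C z) \<le> cmod c * injective_norm nA nB z"
    by (simp only: tensor_sum_scale_fst z)
qed (rule injective_norm_definite)

text \<open>If \<open>R\<close> is conjugate-linear, so is \<open>f \<circ> R\<close>, and the outer
  \<sigma> makes it linear again without changing the modulus. Dividing by \<open>K\<close> brings
  it back into the unit ball.\<close>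

lemma semilinear_dual_ball:
  assumes f: "f \<in> dual_ball n" and \<sigma>: "\<sigma> = id \<or> \<sigma> = cnj" and R: "semilinear \<sigma> R"
    and K: "0 < K" "\<And>a. n (R a) \<le> K * n a"
  shows "(\<lambda>a. \<sigma> (f (R a)) / complex_of_real K) \<in> dual_ball n"
proof -
  have "cmod (\<sigma> (f (R a)) / complex_of_real K) \<le> n a" for a
  proof -
    have "cmod (\<sigma> (f (R a))) = cmod (f (R a))" using \<sigma> by auto
    also have "\<dots> \<le> K * n a" using f K(2)[of a] by (auto simp: dual_ball_def intro: order_trans)
    finally show ?thesis using K(1) by (simp add: norm_divide field_simps)
  qed
  moreover have "clinear (\<lambda>a. \<sigma> (f (R a)) / complex_of_real K)"
    using f \<sigma> R by (auto simp: dual_ball_def clinear_iff semilinear_def scaleC_complex_def add_divide_distrib)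
  ultimately show ?thesis by (simp add: dual_ball_def)
qed

lemma uniform_cross_norm_injective: "uniform_cross_norm nA nB (injective_norm nA nB)"
proof (rule uniform_cross_norm.intro[OF complex_norm_injective_norm], unfold_locales)
  fix a b
  have "injective_norm nA nB (tensor_sum [(a, b)]) \<le> nA a * nB b"
  proof (rule injective_norm_least)
    fix f g assume "f \<in> dual_ball nA" "g \<in> dual_ball nB"
    from dual_pairing_bound[OF this, of "[(a, b)]"]
    show "cmod (\<Sum>(a, b)\<leftarrow>[(a, b)]. f a * g b) \<le> nA a * nB b" by simp
  qed
  then show "injective_norm nA nB (a \<otimes> b) \<le> nA a * nB b" by simp
next
  fix \<sigma> and R :: "'a \<Rightarrow> 'a" and S :: "'b \<Rightarrow> 'b" and K L :: real and r
  assume \<sigma>: "\<sigma> = id \<or> \<sigma> = cnj" and R: "semilinear \<sigma> R" "semilinear \<sigma> S"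
    and K: "0 < K" "0 < L" "\<And>a. nA (R a) \<le> K * nA a" "\<And>b. nB (S b) \<le> L * nB b"
  show "injective_norm nA nB (\<Sum>(a, b)\<leftarrow>r. R a \<otimes> S b) \<le> K * L * injective_norm nA nB (tensor_sum r)"
    unfolding map_tensor_sum
  proof (rule injective_norm_least, unfold sum_list_map_pair)
    fix f g assume fg: "f \<in> dual_ball nA" "g \<in> dual_ball nB"
    let ?f = "\<lambda>a. \<sigma> (f (R a)) / complex_of_real K" and ?g = "\<lambda>b. \<sigma> (g (S b)) / complex_of_real L"
    have "?f \<in> dual_ball nA" "?g \<in> dual_ball nB"
      using semilinear_dual_ball fg \<sigma> R K by blast+
    from injective_norm_upper[OF this, of r]
    have "cmod (\<Sum>(a, b)\<leftarrow>r. ?f a * ?g b) \<le> injective_norm nA nB (tensor_sum r)" .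
    \<comment> \<open>As \<sigma> is a ring homomorphism, it can be pulled out of the whole sum,
      where the modulus absorbs it.\<close>
    moreover have "(\<Sum>(a, b)\<leftarrow>r. ?f a * ?g b)
        = \<sigma> (\<Sum>(a, b)\<leftarrow>r. f (R a) * g (S b)) / complex_of_real (K * L)"
      using \<sigma> by (induction r) (auto simp: add_divide_distrib)
    moreover have "cmod (\<sigma> x / complex_of_real (K * L)) = cmod x / (K * L)" for x
      using \<sigma> K(1,2) by (auto simp: norm_divide norm_mult)
    ultimately have "cmod (\<Sum>(a, b)\<leftarrow>r. f (R a) * g (S b)) / (K * L)
        \<le> injective_norm nA nB (tensor_sum r)"
      by metis
    then show "cmod (\<Sum>(a, b)\<leftarrow>r. f (R a) * g (S b))
        \<le> K * L * injective_norm nA nB (tensor_sum r)"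
      using K(1,2) by (simp add: field_simps)
  qed
qed

section \<open>The projective norm\<close>

lemma sum_nrm_nonneg: "0 \<le> (\<Sum>(a, b)\<leftarrow>r. nA a * nB b)"
  by (induction r) auto

lemma projective_norm_le: "projective_norm nA nB (tensor_sum r) \<le> (\<Sum>(a, b)\<leftarrow>r. nA a * nB b)"
  unfolding projective_norm_def
proof (rule cInf_lower)
  show "bdd_below {(\<Sum>(a, b)\<leftarrow>s. nA a * nB b) |s. tensor_sum r = tensor_sum s}"
    using sum_nrm_nonneg by (intro bdd_belowI[of _ 0]) blast
qed blast

lemma projective_norm_greatest:
  assumes "\<And>r. z = tensor_sum r \<Longrightarrow> c \<le> (\<Sum>(a, b)\<leftarrow>r. nA a * nB b)"
  shows "c \<le> projective_norm nA nB z"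
  unfolding projective_norm_def
proof (rule cInf_greatest)
  obtain r where "z = tensor_sum r" by (rule tensor_sum_surj)
  then show "{(\<Sum>(a, b)\<leftarrow>r. nA a * nB b) |r. z = tensor_sum r} \<noteq> {}" by blast
qed (use assms in auto)

text \<open>Hands nonnegativity and definiteness from the injective to the projective norm.\<close>

lemma injective_le_projective_norm: "injective_norm nA nB z \<le> projective_norm nA nB z"
proof (rule projective_norm_greatest)
  fix r assume "z = tensor_sum r"
  then show "injective_norm nA nB z \<le> (\<Sum>(a, b)\<leftarrow>r. nA a * nB b)"
    using injective_norm_least dual_pairing_bound by blast
qed

lemma complex_norm_projective_norm: "complex_norm (projective_norm nA nB)"
proof (rule complex_normI)
  show "projective_norm nA nB 0 = 0"
    using projective_norm_le[of "[]"] injective_le_projective_norm[of 0] injective_norm_nonneg[of 0]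
    by simp
next
  fix z assume "projective_norm nA nB z = 0"
  then show "z = 0"
    using injective_le_projective_norm[of z] injective_norm_nonneg[of z] injective_norm_definite by simp
next
  fix z w
  \<comment> \<open>Concatenated representations represent the sum. The two infima are taken one
    after the other, with the representation of \<open>w\<close> fixed during the first.\<close>
  have "projective_norm nA nB (z + w) - (\<Sum>(a, b)\<leftarrow>s. nA a * nB b) \<le> projective_norm nA nB z"
    if "w = tensor_sum s" for s
  proof (rule projective_norm_greatest)
    fix r assume "z = tensor_sum r"
    then show "projective_norm nA nB (z + w) - (\<Sum>(a, b)\<leftarrow>s. nA a * nB b) \<le> (\<Sum>(a, b)\<leftarrow>r. nA a * nB b)"
      using projective_norm_le[of "r @ s"] that by simp
  qed
  then have "projective_norm nA nB (z + w) - projective_norm nA nB z \<le> projective_norm nA nB w"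
    by (intro projective_norm_greatest) (simp add: algebra_simps)
  then show "projective_norm nA nB (z + w) \<le> projective_norm nA nB z + projective_norm nA nB w" by simp
next
  fix c z assume c: "c \<noteq> (0 :: complex)"
  have "projective_norm nA nB (c *\<^sub>C z) / cmod c \<le> projective_norm nA nB z"
  proof (rule projective_norm_greatest)
    fix r assume z: "z = tensor_sum r"
    have "(\<Sum>(a, b)\<leftarrow>scale_fst c r. nA a * nB b) = cmod c * (\<Sum>(a, b)\<leftarrow>r. nA a * nB b)"
      by (induction r) (auto simp: A.norm_scale algebra_simps)
    then show "projective_norm nA nB (c *\<^sub>C z) / cmod c \<le> (\<Sum>(a, b)\<leftarrow>r. nA a * nB b)"
      using projective_norm_le[of "scale_fst c r"] c by (simp add: tensor_sum_scale_fst z field_simps)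
  qed
  then show "projective_norm nA nB (c *\<^sub>C z) \<le> cmod c * projective_norm nA nB z"
    using c by (simp add: field_simps)
qed

lemma uniform_cross_norm_projective: "uniform_cross_norm nA nB (projective_norm nA nB)"
proof (rule uniform_cross_norm.intro[OF complex_norm_projective_norm], unfold_locales)
  show "projective_norm nA nB (a \<otimes> b) \<le> nA a * nB b" for a b
    using projective_norm_le[of "[(a, b)]"] by simp
next
  fix \<sigma> and R :: "'a \<Rightarrow> 'a" and S :: "'b \<Rightarrow> 'b" and K L :: real and r
  assume \<sigma>: "\<sigma> = id \<or> \<sigma> = cnj" and R: "semilinear \<sigma> R" "semilinear \<sigma> S"
    and K: "0 < K" "0 < L" "\<And>a. nA (R a) \<le> K * nA a" "\<And>b. nB (S b) \<le> L * nB b"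
  let ?w = "\<Sum>(a, b)\<leftarrow>r. R a \<otimes> S b"
  have "projective_norm nA nB ?w / (K * L) \<le> projective_norm nA nB (tensor_sum r)"
  proof (rule projective_norm_greatest)
    fix s assume "tensor_sum r = tensor_sum s"
    \<comment> \<open>The infimum runs over all representations of the argument, so the image has to
      be computable from each of them.\<close>
    then have w: "?w = (\<Sum>(a, b)\<leftarrow>s. R a \<otimes> S b)"
      by (intro tensor_sum_well_defined[OF \<sigma>])
        (use R in \<open>auto simp: semilinear_def tensor_add_left tensor_add_right tensor_scale_left tensor_scale_right\<close>)
    have "projective_norm nA nB ?w \<le> (\<Sum>(a, b)\<leftarrow>s. nA (R a) * nB (S b))"
      using projective_norm_le[of "map (\<lambda>(a, b). (R a, S b)) s"]
      by (simp only: w sum_list_map_pair flip: map_tensor_sum)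
    also have "\<dots> \<le> (\<Sum>(a, b)\<leftarrow>s. (K * nA a) * (L * nB b))"
    proof (induction s)
      case (Cons p s)
      obtain a b where p: "p = (a, b)" by (cases p)
      have "nA (R a) * nB (S b) \<le> (K * nA a) * (L * nB b)"
        using K A.nrm_nonneg B.nrm_nonneg by (intro mult_mono) auto
      with Cons show ?case by (simp add: p)
    qed simp
    also have "\<dots> = K * L * (\<Sum>(a, b)\<leftarrow>s. nA a * nB b)"
      by (induction s) (auto simp: algebra_simps)
    finally show "projective_norm nA nB ?w / (K * L) \<le> (\<Sum>(a, b)\<leftarrow>s. nA a * nB b)"
      using K(1,2) by (simp add: field_simps)
  qed
  then show "projective_norm nA nB ?w \<le> K * L * projective_norm nA nB (tensor_sum r)"
    using K(1,2) by (simp add: field_simps)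
qed

end

section \<open>The tensor product of quasi *-algebras\<close>

text \<open>Every axiom about left multiplication follows from its right-hand counterpart by
  rewriting \<open>mult x a\<close> as \<open>star (mult (star a) (star x))\<close>.\<close>

lemma quasi_star_algebraI:
  fixes mult :: "'a::complex_vector \<Rightarrow> 'a \<Rightarrow> 'a" and star :: "'a \<Rightarrow> 'a"
  assumes subspace: "complex_vector.subspace A0"
    and closed: "\<And>x y. x \<in> A0 \<Longrightarrow> y \<in> A0 \<Longrightarrow> mult x y \<in> A0" "\<And>x. x \<in> A0 \<Longrightarrow> star x \<in> A0"
    and right_add: "\<And>x a b. x \<in> A0 \<Longrightarrow> mult (a + b) x = mult a x + mult b x"
    and right_scale: "\<And>x c a. x \<in> A0 \<Longrightarrow> mult (c *\<^sub>C a) x = c *\<^sub>C mult a x"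
    and add_right: "\<And>x y a. x \<in> A0 \<Longrightarrow> y \<in> A0 \<Longrightarrow> mult a (x + y) = mult a x + mult a y"
    and scale_right: "\<And>x c a. x \<in> A0 \<Longrightarrow> mult a (c *\<^sub>C x) = c *\<^sub>C mult a x"
    and assoc_middle: "\<And>x y a. x \<in> A0 \<Longrightarrow> y \<in> A0 \<Longrightarrow> mult (mult x a) y = mult x (mult a y)"
    and assoc_right: "\<And>x y a. x \<in> A0 \<Longrightarrow> y \<in> A0 \<Longrightarrow> mult a (mult x y) = mult (mult a x) y"
    and star_add: "\<And>a b. star (a + b) = star a + star b"
    and star_scale: "\<And>c a. star (c *\<^sub>C a) = cnj c *\<^sub>C star a"
    and star_star: "\<And>a. star (star a) = a"
    and star_mult: "\<And>x a. x \<in> A0 \<Longrightarrow> star (mult a x) = mult (star x) (star a)"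
  shows "quasi_star_algebra A0 mult star"
proof -
  have left: "mult x a = star (mult (star a) (star x))" if "x \<in> A0" for x a
    using star_mult[OF closed(2)[OF that]] by (simp add: star_star)
  have left_add: "mult x (a + b) = mult x a + mult x b"
    and left_scale: "mult x (c *\<^sub>C a) = c *\<^sub>C mult x a" if "x \<in> A0" for x a b c
    using closed(2)[OF that]
    by (simp_all add: left[OF that] star_add star_scale right_add right_scale)
  have add_left: "mult (x + y) a = mult x a + mult y a" if "x \<in> A0" "y \<in> A0" for x y a
    using that closed(2) complex_vector.subspace_add[OF subspace]
    by (simp add: left star_add add_right)
  have scale_left: "mult (c *\<^sub>C x) a = c *\<^sub>C mult x a" if "x \<in> A0" for x c a
    using that closed(2) complex_vector.subspace_scale[OF subspace]
    by (simp add: left star_scale scale_right)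
  have star_left: "star (mult x a) = mult (star a) (star x)" if "x \<in> A0" for x a
    using that by (simp add: left star_star)
  show ?thesis
  proof (intro quasi_star_algebra.intro star_algebra.intro quasi_star_algebra_axioms.intro)
    show "clinear (\<lambda>a. mult a x)" "clinear (mult x)" if "x \<in> A0" for x
      using that by (simp_all add: clinear_iff right_add right_scale left_add left_scale)
  qed (rule subspace closed right_add right_scale left_add left_scale add_left scale_left add_right
      scale_right assoc_middle assoc_right star_add star_scale star_star star_mult star_left; assumption)+
qed

locale tensor_quasi_star_algebra =
  A: quasi_star_algebra A0 mA sA + B: quasi_star_algebra B0 mB sB
  for A0 :: "'a::complex_vector set" and mA sA and B0 :: "'b::complex_vector set" and mB sB
begin

abbreviation "T0 \<equiv> tensor_subspace A0 B0"
abbreviation "mT \<equiv> tensor_mult A0 mA B0 mB"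
abbreviation "sT \<equiv> tensor_star sA sB"

lemmas T0_iff = tensor_subspace_iff[OF A.subspace, of _ B0]
lemmas T0_induct = tensor_subspace_induct[OF A.subspace B.subspace, consumes 1, case_names elem add]
lemmas mT_sum = tensor_mult_sum[OF A.quasi_star_algebra_axioms B.quasi_star_algebra_axioms]
lemmas mT_elem = tensor_mult_elem[OF A.quasi_star_algebra_axioms B.quasi_star_algebra_axioms]
lemmas sT_sum = tensor_star_sum[OF A.quasi_star_algebra_axioms B.quasi_star_algebra_axioms]
lemmas sT_elem = tensor_star_elem[OF A.quasi_star_algebra_axioms B.quasi_star_algebra_axioms]

lemma subspace_T0: "complex_vector.subspace T0"
  by (simp add: tensor_subspace_def)

lemma elem_in_T0: "x \<in> A0 \<Longrightarrow> y \<in> B0 \<Longrightarrow> x \<otimes> y \<in> T0"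
  unfolding tensor_subspace_def by (blast intro: complex_vector.span_base)

lemma T0_add: "z \<in> T0 \<Longrightarrow> w \<in> T0 \<Longrightarrow> z + w \<in> T0"
  by (rule complex_vector.subspace_add[OF subspace_T0])

text \<open>One choice of representation that is admissible whenever possible, so that additivity is
  proved at once for both kinds of admissible products.\<close>

lemma tensor_sum_T0:
  "\<exists>r. z = tensor_sum r \<and> (z \<in> T0 \<longrightarrow> set r \<subseteq> A0 \<times> B0)"
proof (cases "z \<in> T0")
  case True
  then show ?thesis using T0_iff by blast
next
  case False
  then show ?thesis using tensor_sum_surj[of z] by blast
qed

text \<open>The hypothesis lists the two ways in which all three products are admissible: both
  summands or the common factor lie in \<open>T0\<close>.\<close>

lemma mT_add_left:
  assumes "z \<in> T0 \<and> w \<in> T0 \<or> u \<in> T0"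
  shows "mT (z + w) u = mT z u + mT w u"
proof -
  obtain r where r: "z = tensor_sum r" "z \<in> T0 \<Longrightarrow> set r \<subseteq> A0 \<times> B0" using tensor_sum_T0 by blast
  obtain s where s: "w = tensor_sum s" "w \<in> T0 \<Longrightarrow> set s \<subseteq> A0 \<times> B0" using tensor_sum_T0 by blast
  obtain t where t: "u = tensor_sum t" "u \<in> T0 \<Longrightarrow> set t \<subseteq> A0 \<times> B0" using tensor_sum_T0 by blast
  have "mT (tensor_sum (r @ s)) (tensor_sum t) = mT (tensor_sum r) (tensor_sum t) + mT (tensor_sum s) (tensor_sum t)"
    using assms r(2) s(2) t(2) by (subst (1 2 3) mT_sum) auto
  then show ?thesis by (simp add: r(1) s(1) t(1))
qed

lemma mT_add_right:
  assumes "z \<in> T0 \<and> w \<in> T0 \<or> u \<in> T0"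
  shows "mT u (z + w) = mT u z + mT u w"
proof -
  obtain r where r: "z = tensor_sum r" "z \<in> T0 \<Longrightarrow> set r \<subseteq> A0 \<times> B0" using tensor_sum_T0 by blast
  obtain s where s: "w = tensor_sum s" "w \<in> T0 \<Longrightarrow> set s \<subseteq> A0 \<times> B0" using tensor_sum_T0 by blast
  obtain t where t: "u = tensor_sum t" "u \<in> T0 \<Longrightarrow> set t \<subseteq> A0 \<times> B0" using tensor_sum_T0 by blast
  have "mT (tensor_sum t) (tensor_sum (r @ s)) = mT (tensor_sum t) (tensor_sum r) + mT (tensor_sum t) (tensor_sum s)"
    using assms r(2) s(2) t(2) by (subst (1 2 3) mT_sum) (auto simp: sum_list_pair_add)
  then show ?thesis by (simp add: r(1) s(1) t(1))
qed

lemma mT_scale: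
  assumes u: "u \<in> T0"
  shows "mT (c *\<^sub>C z) u = c *\<^sub>C mT z u" and "mT z (c *\<^sub>C u) = c *\<^sub>C mT z u"
proof -
  have cu: "c *\<^sub>C u \<in> T0" using u by (rule complex_vector.subspace_scale[OF subspace_T0])
  show "mT (c *\<^sub>C z) u = c *\<^sub>C mT z u"
  proof (induction z rule: tensor_induct)
    case (elem a b)
    show ?case using u
    proof (induction rule: T0_induct)
      case (elem x y)
      then show ?case
        using A.right_mult_linear[of x] by (simp add: mT_elem clinear_iff flip: tensor_scale_left)
    qed (simp add: mT_add_right scaleC_add_right)
  qed (simp add: mT_add_left u scaleC_add_right)
  show "mT z (c *\<^sub>C u) = c *\<^sub>C mT z u"
  proof (induction z rule: tensor_induct)
    case (elem a b)
    show ?case using u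
    proof (induction rule: T0_induct)
      case (elem x y)
      then show ?case
        using complex_vector.subspace_scale[OF A.subspace, of x c]
        by (simp add: mT_elem A.mult_scale_right flip: tensor_scale_left)
    qed (simp add: mT_add_right scaleC_add_right complex_vector.subspace_scale[OF subspace_T0])
  qed (simp add: mT_add_left u cu scaleC_add_right)
qed

lemma sT_add: "sT (z + w) = sT z + sT w"
proof -
  obtain r s where "z = tensor_sum r" "w = tensor_sum s" by (meson tensor_sum_surj)
  then show ?thesis using sT_sum[of "r @ s"] sT_sum[of r] sT_sum[of s] by simp
qed

lemma sT_scale: "sT (c *\<^sub>C z) = cnj c *\<^sub>C sT z"
  by (induction z rule: tensor_induct)
    (simp_all add: sT_elem sT_add scaleC_add_right A.star_scale flip: tensor_scale_left)

lemma sT_sT: "sT (sT z) = z"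
  by (induction z rule: tensor_induct) (simp_all add: sT_elem sT_add A.star_star B.star_star)

lemma sT_closed: "x \<in> T0 \<Longrightarrow> sT x \<in> T0"
  by (induction rule: T0_induct)
    (simp_all add: sT_elem sT_add T0_add elem_in_T0 A.star_closed B.star_closed)

lemma mT_closed:
  assumes "x \<in> T0" "y \<in> T0" shows "mT x y \<in> T0"
  using assms(1)
proof (induction rule: T0_induct)
  case (elem a b)
  show ?case using assms(2)
    by (induction rule: T0_induct)
      (simp_all add: elem mT_elem mT_add_right T0_add elem_in_T0 A.mult_closed B.mult_closed)
qed (simp add: mT_add_left T0_add)

text \<open>With \<open>x\<close> and \<open>y\<close> in \<open>T0\<close> every product involved
  is additive in each argument, which reduces the claim to elementary tensors and thus to the two
  factors.\<close>

lemma mT_assoc_middle: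
  assumes x: "x \<in> T0" and y: "y \<in> T0"
  shows "mT (mT x z) y = mT x (mT z y)"
proof (induction z rule: tensor_induct)
  case (elem a b)
  show ?case using x
  proof (induction rule: T0_induct)
    case (elem p q)
    then have pq: "p \<otimes> q \<in> T0" by (simp add: elem_in_T0)
    show ?case using y
      by (induction rule: T0_induct)
        (use elem in \<open>simp_all add: mT_elem mT_add_right pq A.assoc_middle B.assoc_middle\<close>)
  qed (simp add: mT_add_left y)
qed (simp add: mT_add_right mT_add_left x y)

lemma mT_assoc_right:
  assumes x: "x \<in> T0" and y: "y \<in> T0"
  shows "mT z (mT x y) = mT (mT z x) y"
proof (induction z rule: tensor_induct)
  case (elem a b)
  show ?case using x
  proof (induction rule: T0_induct)
    case (elem p q)
    then have pq: "p \<otimes> q \<in> T0" by (simp add: elem_in_T0)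
    show ?case using y
      by (induction rule: T0_induct)
        (use elem in \<open>simp_all add: mT_elem mT_add_right pq mT_closed A.assoc_right B.assoc_right
          A.mult_closed B.mult_closed\<close>)
  qed (simp add: mT_add_left mT_add_right mT_closed y)
qed (simp add: mT_add_left mT_closed x y)

lemma sT_mT:
  assumes x: "x \<in> T0"
  shows "sT (mT z x) = mT (sT x) (sT z)"
proof (induction z rule: tensor_induct)
  case (elem a b)
  show ?case using x
    by (induction rule: T0_induct)
      (simp_all add: mT_elem sT_elem mT_add_right mT_add_left sT_add sT_closed A.star_closed
        B.star_closed A.star_mult_right B.star_mult_right)
qed (simp add: mT_add_right mT_add_left sT_add sT_closed x)

lemma quasi_star_algebra_tensor: "quasi_star_algebra T0 mT sT"
  by (rule quasi_star_algebraI; (rule mT_assoc_middle mT_assoc_right; assumption)?)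
    (simp_all add: subspace_T0 mT_closed sT_closed mT_add_left mT_add_right mT_scale
      sT_add sT_scale sT_sT sT_mT)

end

section \<open>Norm estimates for the multiplications and density\<close>

context normed_quasi_star_algebra
begin

lemma right_mult_bounded:
  assumes "x \<in> A0"
  obtains K where "0 < K" "\<And>a. nrm (mult a x) \<le> K * nrm a"
proof -
  have "\<exists>K>0. \<forall>a. nrm (mult a x) \<le> K * nrm a"
    using right_mult_continuous[OF assms]
      clinear_continuous_iff_bounded[OF complex_norm_axioms complex_norm_axioms right_mult_linear[OF assms]]
    by simp
  then show thesis using that by blast
qed

text \<open>The isometric involution conjugates left multiplication by \<open>x\<close> into right
  multiplication by \<open>star x\<close>, with the same bound.\<close>

lemma left_mult_bounded:
  assumes "x \<in> A0"
  obtains K where "0 < K" "\<And>a. nrm (mult x a) \<le> K * nrm a"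
proof -
  obtain K where K: "0 < K" "\<And>a. nrm (mult a (star x)) \<le> K * nrm a"
    using right_mult_bounded[OF star_closed[OF assms]] by metis
  have "nrm (mult x a) \<le> K * nrm a" for a
    using K(2)[of "star a"] norm_star[of "mult x a"] by (simp add: star_mult_left[OF assms] norm_star)
  with K(1) show thesis by (rule that)
qed

lemma dense_approx:
  assumes "0 < e" obtains x where "x \<in> A0" "nrm (a - x) < e"
proof -
  have "\<exists>x\<in>A0. nrm (a - x) < e"
    using dense assms by (simp add: closure_of_eq_UNIV_iff)
  then show thesis using that by blast
qed

end

lemma normed_quasi_star_algebra_tensor:
  assumes nA: "normed_quasi_star_algebra nA A0 mA sA" and nB: "normed_quasi_star_algebra nB B0 mB sB"
    and \<alpha>: "uniform_cross_norm nA nB \<alpha>"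
  shows "normed_quasi_star_algebra \<alpha> (tensor_subspace A0 B0) (tensor_mult A0 mA B0 mB) (tensor_star sA sB)"
proof -
  interpret A: normed_quasi_star_algebra nA A0 mA sA by (rule nA)
  interpret B: normed_quasi_star_algebra nB B0 mB sB by (rule nB)
  interpret \<alpha>: uniform_cross_norm nA nB \<alpha> by (rule \<alpha>)
  interpret T: tensor_quasi_star_algebra A0 mA sA B0 mB sB by unfold_locales
  have star_le: "\<alpha> (T.sT z) \<le> \<alpha> z" for z
  proof -
    obtain r where z: "z = tensor_sum r" by (rule tensor_sum_surj)
    show ?thesis
      using \<alpha>.uniform[of cnj sA sB 1 1 r]
      by (simp add: z T.sT_sum semilinear_def A.star_add A.star_scale B.star_add B.star_scale
          A.norm_star B.norm_star)
  qed
  have approx: "\<forall>e>0. \<exists>v\<in>T.T0. \<alpha> (z - v) < e" for z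
  proof (induction z rule: tensor_induct)
    case (elem a b)
    show ?case
    proof (intro allI impI)
      fix e :: real assume e: "0 < e"
      \<comment> \<open>The summand 1 avoids division by zero when \<open>b = 0\<close>. The element
        \<open>y\<close> is chosen after \<open>x\<close>, since its tolerance depends on
        \<open>nA x\<close>.\<close>
      have pos: "0 < nB b + 1" using B.nrm_nonneg[of b] by linarith
      obtain x where x: "x \<in> A0" "nA (a - x) < e / 2 / (nB b + 1)"
        using A.dense_approx[of "e / 2 / (nB b + 1)" a] e pos by auto
      have pos': "0 < nA x + 1" using A.nrm_nonneg[of x] by linarith
      obtain y where y: "y \<in> B0" "nB (b - y) < e / 2 / (nA x + 1)"
        using B.dense_approx[of "e / 2 / (nA x + 1)" b] e pos' by auto
      have "nA (a - x) * nB b \<le> nA (a - x) * (nB b + 1)" by (simp add: mult_left_mono)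
      also have "\<dots> < e / 2" using x(2) pos by (simp only: pos_less_divide_eq)
      finally have 1: "nA (a - x) * nB b < e / 2" .
      have "nA x * nB (b - y) \<le> nB (b - y) * (nA x + 1)" by (simp add: algebra_simps)
      also have "\<dots> < e / 2" using y(2) pos' by (simp only: pos_less_divide_eq)
      finally have 2: "nA x * nB (b - y) < e / 2" .
      have "a \<otimes> b - x \<otimes> y = (a - x) \<otimes> b + x \<otimes> (b - y)"
        by (simp add: tensor_diff_left tensor_diff_right)
      then have "\<alpha> (a \<otimes> b - x \<otimes> y) < e"
        using \<alpha>.norm_triangle[of "(a - x) \<otimes> b" "x \<otimes> (b - y)"] \<alpha>.cross[of "a - x" b]
          \<alpha>.cross[of x "b - y"] 1 2 by simp
      then show "\<exists>v\<in>T.T0. \<alpha> (a \<otimes> b - v) < e" using T.elem_in_T0[OF x(1) y(1)] by blast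
    qed
  next
    case (add z w)
    show ?case
    proof (intro allI impI)
      fix e :: real assume "0 < e"
      then have "0 < e / 2" by simp
      then obtain u v where "u \<in> T.T0" "\<alpha> (z - u) < e / 2" "v \<in> T.T0" "\<alpha> (w - v) < e / 2"
        using add by blast
      moreover have "\<alpha> (z + w - (u + v)) \<le> \<alpha> (z - u) + \<alpha> (w - v)"
        using \<alpha>.norm_triangle[of "z - u" "w - v"] by (simp add: algebra_simps)
      ultimately show "\<exists>v\<in>T.T0. \<alpha> (z + w - v) < e"
        by (intro bexI[of _ "u + v"]) (auto simp: T.T0_add)
    qed
  qed
  \<comment> \<open>Bounds multiply on elementary multipliers and add up on sums; since every
    element of \<open>T0\<close> is a finite sum of such, some bound results.\<close>
  have bounded: "\<exists>K>0. \<forall>z. \<alpha> (T.mT z x) \<le> K * \<alpha> z" if "x \<in> T.T0" for x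
    using that
  proof (induction rule: T.T0_induct)
    case (elem x y)
    obtain K where K: "0 < K" "\<And>a. nA (mA a x) \<le> K * nA a"
      using A.right_mult_bounded[OF elem(1)] by metis
    obtain L where L: "0 < L" "\<And>b. nB (mB b y) \<le> L * nB b"
      using B.right_mult_bounded[OF elem(2)] by metis
    have "\<alpha> (T.mT z (x \<otimes> y)) \<le> K * L * \<alpha> z" for z
    proof -
      obtain r where z: "z = tensor_sum r" by (rule tensor_sum_surj)
      have "T.mT z (x \<otimes> y) = (\<Sum>(a, b)\<leftarrow>r. mA a x \<otimes> mB b y)"
        using T.mT_sum[of r "[(x, y)]"] elem by (simp add: z)
      then show ?thesis
        using \<alpha>.uniform[of id "\<lambda>a. mA a x" "\<lambda>b. mB b y" K L r] K L elem
          A.right_mult_linear[of x] B.right_mult_linear[of y]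
        by (simp add: z semilinear_def clinear_iff)
    qed
    with K(1) L(1) show ?case by (intro exI[of _ "K * L"]) auto
  next
    case (add x y)
    then obtain K L where KL: "0 < K" "0 < L" "\<And>z. \<alpha> (T.mT z x) \<le> K * \<alpha> z" "\<And>z. \<alpha> (T.mT z y) \<le> L * \<alpha> z"
      by blast
    have "\<alpha> (T.mT z (x + y)) \<le> (K + L) * \<alpha> z" for z
      using \<alpha>.norm_triangle[of "T.mT z x" "T.mT z y"] KL(3,4)[of z] add(1,2)
      by (simp add: T.mT_add_right algebra_simps)
    with KL(1,2) show ?case by (intro exI[of _ "K + L"]) auto
  qed
  show ?thesis
  proof (rule normed_quasi_star_algebra.intro[OF T.quasi_star_algebra_tensor \<alpha>.complex_norm_axioms],
      unfold_locales)
    \<comment> \<open>A contractive involution is isometric: the inequality is applied to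
      \<open>z\<close> and to its image.\<close>
    show "\<alpha> (T.sT z) = \<alpha> z" for z
      using star_le[of z] star_le[of "T.sT z"] by (simp add: T.sT_sT)
    show "norm_topology \<alpha> closure_of T.T0 = UNIV"
      using approx by (simp add: \<alpha>.closure_of_eq_UNIV_iff)
    show "continuous_map (norm_topology \<alpha>) (norm_topology \<alpha>) (\<lambda>z. T.mT z x)" if "x \<in> T.T0" for x
      using bounded[OF that] that
      by (subst clinear_continuous_iff_bounded[OF \<alpha>.complex_norm_axioms \<alpha>.complex_norm_axioms])
        (auto simp: clinear_iff T.mT_add_left T.mT_scale)
  qed
qed

section \<open>Completions\<close>

text \<open>The Lipschitz estimate makes the images of approximating sequences converge, and their limit
  independent of the sequence.\<close>

lemma extend_Lipschitz_to_completion: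
  fixes nV :: "'v::complex_vector \<Rightarrow> real" and nC :: "'c::complex_vector \<Rightarrow> real"
  assumes nV: "complex_norm nV" and compl: "is_completion nV nC \<iota>"
    and K: "\<And>v w. nV (T v - T w) \<le> K * nV (v - w)"
  obtains T' where "continuous_map (norm_topology nC) (norm_topology nC) T'"
    "\<And>v. T' (\<iota> v) = \<iota> (T v)"
proof -
  interpret V: complex_norm nV by (rule nV)
  interpret C: complex_norm nC using compl by (simp add: is_completion_def)
  have lin: "clinear \<iota>" and iso: "nC (\<iota> v) = nV v" for v
    using compl by (auto simp: is_completion_def)
  have diff: "nC (\<iota> v - \<iota> w) = nV (v - w)" for v w
    using iso[of "v - w"] by (simp add: complex_vector.linear_diff[OF lin])
  have approx: "\<exists>s :: nat \<Rightarrow> 'v. (\<lambda>i. nC (\<iota> (s i) - u)) \<longlonglongrightarrow> 0" for u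
  proof -
    have "\<exists>v. nC (u - \<iota> v) < inverse (real (Suc i))" for i
      using compl unfolding is_completion_def C.closure_of_eq_UNIV_iff by (metis (no_types) imageE inverse_positive_iff_positive of_nat_0_less_iff zero_less_Suc)
    then obtain s where "\<And>i. nC (u - \<iota> (s i)) < inverse (real (Suc i))" by metis
    then have "\<forall>i. norm (nC (\<iota> (s i) - u)) \<le> inverse (real (Suc i))"
      by (simp add: C.nrm_diff_commute[of _ u] less_imp_le)
    then have "(\<lambda>i. nC (\<iota> (s i) - u)) \<longlonglongrightarrow> 0"
      by (intro Lim_null_comparison[OF _ LIMSEQ_inverse_real_of_nat]) simp
    then show ?thesis by blast
  qed
  then obtain s :: "'c \<Rightarrow> nat \<Rightarrow> 'v" where s: "\<And>u. (\<lambda>i. nC (\<iota> (s u i) - u)) \<longlonglongrightarrow> 0" by metis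
  have diff_le: "nC (\<iota> (T v) - \<iota> (T w)) \<le> K * nC (\<iota> v - \<iota> w)" for v w
    using K by (simp add: diff)
  have "\<exists>l. (\<lambda>i. nC (\<iota> (T (s u i)) - l)) \<longlonglongrightarrow> 0" for u
  proof -
    have "\<forall>e>0. \<exists>N. \<forall>i\<ge>N. \<forall>j\<ge>N. nC (\<iota> (T (s u i)) - \<iota> (T (s u j))) < e"
    proof (intro allI impI)
      fix e :: real assume e: "0 < e"
      \<comment> \<open>Two members of the sequence differ by less than \<open>2 * ?d\<close>, which
        the factor \<open>\<bar>K\<bar> + 1\<close> turns into \<open>e\<close>.\<close>
      let ?d = "e / (2 * (\<bar>K\<bar> + 1))"
      have d: "0 < ?d" using e by simp
      obtain N where N: "\<And>i. i \<ge> N \<Longrightarrow> nC (\<iota> (s u i) - u) < ?d"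
        using LIMSEQ_D[OF s d] by (metis abs_of_nonneg C.nrm_nonneg diff_zero real_norm_def)
      have "nC (\<iota> (T (s u i)) - \<iota> (T (s u j))) < e" if "i \<ge> N" "j \<ge> N" for i j
      proof -
        have "nC (\<iota> (s u i) - \<iota> (s u j)) < 2 * ?d"
          using C.nrm_triangle_sub[of "\<iota> (s u i)" "\<iota> (s u j)" u] N[OF that(1)] N[OF that(2)]
          by (simp add: C.nrm_diff_commute[of u])
        then have *: "(\<bar>K\<bar> + 1) * nC (\<iota> (s u i) - \<iota> (s u j)) < e"
          by (simp add: field_simps)
        have "nC (\<iota> (T (s u i)) - \<iota> (T (s u j))) \<le> K * nC (\<iota> (s u i) - \<iota> (s u j))"
          by (rule diff_le)
        also have "\<dots> \<le> (\<bar>K\<bar> + 1) * nC (\<iota> (s u i) - \<iota> (s u j))"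
          by (intro mult_right_mono) auto
        finally show ?thesis using * by linarith
      qed
      then show "\<exists>N. \<forall>i\<ge>N. \<forall>j\<ge>N. nC (\<iota> (T (s u i)) - \<iota> (T (s u j))) < e" by blast
    qed
    moreover have "norm_complete nC" using compl by (simp add: is_completion_def)
    ultimately show ?thesis by (intro C.norm_complete_iff[THEN iffD1, THEN spec, THEN mp])
  qed
  then obtain T' where T': "\<And>u. (\<lambda>i. nC (\<iota> (T (s u i)) - T' u)) \<longlonglongrightarrow> 0" by metis
  have Lip: "nC (T' u - T' w) \<le> K * nC (u - w)" for u w
  proof -
    \<comment> \<open>The Lipschitz estimate is passed to the limit: the sequence bounds the
      distance of the images for every \<open>i\<close>, and its error terms tend to 0.\<close>
    have "(\<lambda>i. nC (\<iota> (T (s u i)) - T' u) + nC (\<iota> (T (s w i)) - T' w)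
        + \<bar>K\<bar> * (nC (\<iota> (s u i) - u) + nC (\<iota> (s w i) - w)) + K * nC (u - w))
      \<longlonglongrightarrow> 0 + 0 + \<bar>K\<bar> * (0 + 0) + K * nC (u - w)"
      by (intro tendsto_intros T' s)
    moreover have "nC (T' u - T' w) \<le> nC (\<iota> (T (s u i)) - T' u) + nC (\<iota> (T (s w i)) - T' w)
        + \<bar>K\<bar> * (nC (\<iota> (s u i) - u) + nC (\<iota> (s w i) - w)) + K * nC (u - w)" for i
    proof -
      let ?x = "\<iota> (s u i)" and ?y = "\<iota> (s w i)" and ?p = "\<iota> (T (s u i))" and ?q = "\<iota> (T (s w i))"
      have 1: "nC (T' u - T' w) \<le> nC (?p - T' u) + nC (?p - ?q) + nC (?q - T' w)"
        using C.nrm_triangle_sub[of "T' u" "T' w" ?p] C.nrm_triangle_sub[of ?p "T' w" ?q]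
        by (simp add: C.nrm_diff_commute[of "T' u"])
      \<comment> \<open>Both signs are needed, because the difference is multiplied by
        \<open>K\<close>, whose sign is unspecified.\<close>
      have 2: "\<bar>nC (?x - ?y) - nC (u - w)\<bar> \<le> nC (?x - u) + nC (?y - w)"
        using C.nrm_triangle_sub[of ?x ?y u] C.nrm_triangle_sub[of u ?y w]
          C.nrm_triangle_sub[of u w ?x] C.nrm_triangle_sub[of ?x w ?y]
        by (simp add: C.nrm_diff_commute[of u ?x] C.nrm_diff_commute[of w ?y] abs_le_iff)
      have "K * nC (?x - ?y) = K * (nC (?x - ?y) - nC (u - w)) + K * nC (u - w)"
        by (simp add: algebra_simps)
      also have "\<dots> \<le> \<bar>K\<bar> * \<bar>nC (?x - ?y) - nC (u - w)\<bar> + K * nC (u - w)"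
        by (simp add: abs_mult[symmetric])
      also have "\<dots> \<le> \<bar>K\<bar> * (nC (?x - u) + nC (?y - w)) + K * nC (u - w)"
        using 2 by (simp add: mult_left_mono)
      finally show ?thesis using 1 diff_le[of "s u i" "s w i"] by linarith
    qed
    ultimately show ?thesis by (intro LIMSEQ_le_const) auto
  qed
  have "T' (\<iota> v) = \<iota> (T v)" for v
  \<comment> \<open>The sequence chosen for \<open>\<iota> v\<close> need not be constant, so
    agreement with \<open>T\<close> rests on uniqueness of limits.\<close>
  proof (rule C.limit_unique[OF T'[of "\<iota> v"]])
    have "norm (nC (\<iota> (T (s (\<iota> v) i)) - \<iota> (T v))) \<le> K * nC (\<iota> (s (\<iota> v) i) - \<iota> v)" for i
      using diff_le by simp
    then show "(\<lambda>i. nC (\<iota> (T (s (\<iota> v) i)) - \<iota> (T v))) \<longlonglongrightarrow> 0"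
      by (intro Lim_null_comparison[OF always_eventually tendsto_mult_right_zero[OF s]] allI)
  qed
  moreover have "continuous_map (norm_topology nC) (norm_topology nC) T'"
    by (rule continuous_map_norm_Lipschitz[OF C.complex_norm_axioms C.complex_norm_axioms Lip])
  ultimately show thesis using that by blast
qed

locale quasi_star_completion = V: normed_quasi_star_algebra nV V0 mV sV
  for nV :: "'v::complex_vector \<Rightarrow> real" and V0 mV sV +
  fixes nC :: "'c::complex_vector \<Rightarrow> real" and \<iota> :: "'v \<Rightarrow> 'c"
  assumes compl: "is_completion nV nC \<iota>"
begin

sublocale C: complex_norm nC
  using compl by (simp add: is_completion_def)

abbreviation "cont f \<equiv> continuous_map (norm_topology nC) (norm_topology nC) f"

lemma \<iota>_linear: "clinear \<iota>" and nC_\<iota>: "nC (\<iota> v) = nV v"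
  using compl by (auto simp: is_completion_def)

lemma \<iota>_add: "\<iota> (v + w) = \<iota> v + \<iota> w" and \<iota>_scale: "\<iota> (c *\<^sub>C v) = c *\<^sub>C \<iota> v"
  using \<iota>_linear by (auto simp: clinear_iff)

lemma \<iota>_diff: "\<iota> (v - w) = \<iota> v - \<iota> w"
  by (rule complex_vector.linear_diff[OF \<iota>_linear])

lemma inj_\<iota>: "inj \<iota>"
proof (rule injI)
  fix v w assume "\<iota> v = \<iota> w"
  then have "nV (v - w) = 0" using nC_\<iota>[of "v - w"] by (simp add: \<iota>_diff)
  then show "v = w" using V.norm_eq_zero_iff[of "v - w"] by simp
qed

lemma cont_eq:
  assumes "cont f" "cont g" "\<And>v. f (\<iota> v) = g (\<iota> v)"
  shows "f u = g u"
  using continuous_map_eq_on_dense[OF C.complex_norm_axioms C.complex_norm_axioms assms(1,2), of "range \<iota>"]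
    compl assms(3) by (auto simp: is_completion_def)

lemma cont_comp: "cont f \<Longrightarrow> cont g \<Longrightarrow> cont (\<lambda>u. f (g u))"
  using continuous_map_compose[of _ _ g _ f] by (simp add: o_def)

lemmas cont_add = continuous_map_norm_add[OF C.complex_norm_axioms C.complex_norm_axioms]

lemma cont_const: "cont (\<lambda>u. w)"
  by (rule continuous_map_norm_Lipschitz[OF C.complex_norm_axioms C.complex_norm_axioms, of _ 0]) simp

lemma cont_id: "cont (\<lambda>u. u)"
  by (rule continuous_map_norm_Lipschitz[OF C.complex_norm_axioms C.complex_norm_axioms, of _ 1]) simp

lemma cont_scale: "cont f \<Longrightarrow> cont (\<lambda>u. c *\<^sub>C f u)"
  by (rule cont_comp[OF continuous_map_norm_scale[OF C.complex_norm_axioms]])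

text \<open>The two arguments are released from the dense range one after the other, which keeps the
  argument within continuity in one variable.\<close>

lemma additive_by_density:
  assumes "cont T" "\<And>v w. T (\<iota> v + \<iota> w) = T (\<iota> v) + T (\<iota> w)"
  shows "T (u + u') = T u + T u'"
proof -
  note c = cont_comp[OF assms(1)] cont_add cont_const cont_id assms(1)
  have 1: "T (u + \<iota> w) = T u + T (\<iota> w)" for u w
    by (rule cont_eq[of "\<lambda>u. T (u + \<iota> w)" "\<lambda>u. T u + T (\<iota> w)"]) (intro c | rule assms(2))+
  show ?thesis
    by (rule cont_eq[of "\<lambda>u'. T (u + u')" "\<lambda>u'. T u + T u'"]) (intro c | rule 1)+
qed

lemma extension_exists: "\<exists>mC sC. extended_by_continuity nC \<iota> V0 mV sV mC sC"
proof -
  note ext = extend_Lipschitz_to_completion[OF V.complex_norm_axioms compl]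
  have "\<exists>R. cont R \<and> (\<forall>v. R (\<iota> v) = \<iota> (mV v x))" if x: "x \<in> V0" for x
  proof -
    obtain K where K: "\<And>a. nV (mV a x) \<le> K * nV a" using V.right_mult_bounded[OF x] by metis
    have "nV (mV v x - mV w x) \<le> K * nV (v - w)" for v w
      using K[of "v - w"] complex_vector.linear_diff[OF V.right_mult_linear[OF x], of v w] by simp
    then show ?thesis by (rule ext[where T = "\<lambda>v. mV v x"]) blast
  qed
  then obtain R where R: "\<And>x. x \<in> V0 \<Longrightarrow> cont (R x)" "\<And>x v. x \<in> V0 \<Longrightarrow> R x (\<iota> v) = \<iota> (mV v x)"
    by metis
  have "\<exists>L. cont L \<and> (\<forall>v. L (\<iota> v) = \<iota> (mV x v))" if x: "x \<in> V0" for x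
  proof -
    obtain K where K: "\<And>a. nV (mV x a) \<le> K * nV a" using V.left_mult_bounded[OF x] by metis
    have "nV (mV x v - mV x w) \<le> K * nV (v - w)" for v w
      using K[of "v - w"] complex_vector.linear_diff[OF V.left_mult_linear[OF x], of v w] by simp
    then show ?thesis by (rule ext[where T = "\<lambda>v. mV x v"]) blast
  qed
  then obtain L where L: "\<And>x. x \<in> V0 \<Longrightarrow> cont (L x)" "\<And>x v. x \<in> V0 \<Longrightarrow> L x (\<iota> v) = \<iota> (mV x v)"
    by metis
  have "nV (sV v - sV w) \<le> 1 * nV (v - w)" for v w
  proof -
    have "sV v - sV w = sV (v - w)" using V.star_add[of "v - w" w] by simp
    then show ?thesis by (simp add: V.norm_star)
  qed
  then obtain S where S: "cont S" "\<And>v. S (\<iota> v) = \<iota> (sV v)"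
    by (rule ext[where T = sV]) blast
  \<comment> \<open>One symbol has to carry both families. If both factors come from
    \<open>V0\<close>, the operators \<open>R\<close> and \<open>L\<close> agree; if neither does,
    the value is arbitrary and unconstrained.\<close>
  define mC where "mC u w = (if w \<in> \<iota> ` V0 then R (inv \<iota> w) u else L (inv \<iota> u) w)" for u w
  have mR: "mC u (\<iota> x) = R x u" if "x \<in> V0" for u x
    using that by (simp add: mC_def inv_f_f[OF inj_\<iota>])
  have mL: "mC (\<iota> x) = L x" if "x \<in> V0" for x
    using that R(2) L(2) by (auto simp: fun_eq_iff mC_def inv_f_f[OF inj_\<iota>])
  show ?thesis
    unfolding extended_by_continuity_def
    by (rule exI[of _ mC], rule exI[of _ S]) (simp add: S R L mR mL)
qed

lemma extension_Banach:
  assumes ext: "extended_by_continuity nC \<iota> V0 mV sV mC sC"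
  shows "Banach_quasi_star_algebra nC (\<iota> ` V0) mC sC"
proof -
  have cS: "cont sC" and S: "\<And>v. sC (\<iota> v) = \<iota> (sV v)"
    and cR: "\<And>x. x \<in> V0 \<Longrightarrow> cont (\<lambda>u. mC u (\<iota> x))" and cL: "\<And>x. x \<in> V0 \<Longrightarrow> cont (\<lambda>u. mC (\<iota> x) u)"
    and R: "\<And>x v. x \<in> V0 \<Longrightarrow> mC (\<iota> v) (\<iota> x) = \<iota> (mV v x)"
    and L: "\<And>x v. x \<in> V0 \<Longrightarrow> mC (\<iota> x) (\<iota> v) = \<iota> (mV x v)"
    using ext unfolding extended_by_continuity_def by blast+
  note c = cont_add cont_scale cont_id cont_const cS cR cL cont_comp[OF cS] cont_comp[OF cR]
    cont_comp[OF cL]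
  have V0_add: "x + y \<in> V0" if "x \<in> V0" "y \<in> V0" for x y
    using that by (rule complex_vector.subspace_add[OF V.subspace])
  have V0_scale: "k *\<^sub>C x \<in> V0" if "x \<in> V0" for k x
    using that by (rule complex_vector.subspace_scale[OF V.subspace])
  have right_lin: "mV (a + b) x = mV a x + mV b x" "mV (k *\<^sub>C a) x = k *\<^sub>C mV a x" if "x \<in> V0" for a b k x
    using V.right_mult_linear[OF that] by (auto simp: clinear_iff)
  have star_norm: "nC (sC u) = nC u" for u
  proof -
    \<comment> \<open>The norm is viewed as complex-valued so that the density principle, stated for
      norm topologies of complex spaces, applies to it.\<close>
    have cn: "continuous_map (norm_topology nC) (norm_topology cmod) (\<lambda>u. complex_of_real (nC u))"
    proof (rule continuous_map_norm_Lipschitz[OF C.complex_norm_axioms complex_norm_cmod, of _ 1])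
      show "cmod (complex_of_real (nC a) - complex_of_real (nC b)) \<le> 1 * nC (a - b)" for a b
        using C.norm_triangle[of "a - b" b] C.norm_triangle[of "b - a" a]
        by (simp add: C.nrm_diff_commute[of b] abs_le_iff flip: of_real_diff)
    qed
    have "complex_of_real (nC (sC u)) = complex_of_real (nC u)"
    proof (rule continuous_map_eq_on_dense[OF C.complex_norm_axioms complex_norm_cmod _ cn])
      show "continuous_map (norm_topology nC) (norm_topology cmod) (\<lambda>u. complex_of_real (nC (sC u)))"
        using continuous_map_compose[OF cS cn] by (simp add: o_def)
      show "norm_topology nC closure_of range \<iota> = UNIV" using compl by (simp add: is_completion_def)
    qed (auto simp: S nC_\<iota> V.norm_star)
    then show ?thesis by simp
  qed
  have "quasi_star_algebra (\<iota> ` V0) mC sC"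
  proof (rule quasi_star_algebraI; (elim imageE)?)
    show "complex_vector.subspace (\<iota> ` V0)"
      by (rule complex_vector.linear_subspace_image[OF \<iota>_linear V.subspace])
  next
    fix x y x' y' assume "x = \<iota> x'" "y = \<iota> y'" "x' \<in> V0" "y' \<in> V0"
    then show "mC x y \<in> \<iota> ` V0" by (simp add: R V.mult_closed)
  next
    fix x x' assume "x = \<iota> x'" "x' \<in> V0"
    then show "sC x \<in> \<iota> ` V0" by (simp add: S V.star_closed)
  next
    fix x a b x' assume x: "x = \<iota> x'" "x' \<in> V0"
    show "mC (a + b) x = mC a x + mC b x"
      unfolding x(1) by (rule additive_by_density[OF cR[OF x(2)]])
        (simp add: R x(2) right_lin flip: \<iota>_add)
  next
    fix x k a x' assume x: "x = \<iota> x'" "x' \<in> V0"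
    show "mC (k *\<^sub>C a) x = k *\<^sub>C mC a x"
      unfolding x(1)
      by (rule cont_eq[of "\<lambda>a. mC (k *\<^sub>C a) (\<iota> x')" "\<lambda>a. k *\<^sub>C mC a (\<iota> x')"])
        ((intro c x(2))+, simp add: R x(2) right_lin flip: \<iota>_scale)
  next
    fix x y a x' y' assume x: "x = \<iota> x'" "x' \<in> V0" and y: "y = \<iota> y'" "y' \<in> V0"
    show "mC a (x + y) = mC a x + mC a y"
      unfolding x(1) y(1) \<iota>_add[symmetric]
      by (rule cont_eq[of "\<lambda>a. mC a (\<iota> (x' + y'))" "\<lambda>a. mC a (\<iota> x') + mC a (\<iota> y')"])
        ((intro c x(2) y(2) V0_add)+, simp add: R x(2) y(2) V0_add V.mult_add_right flip: \<iota>_add)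
  next
    fix x k a x' assume x: "x = \<iota> x'" "x' \<in> V0"
    show "mC a (k *\<^sub>C x) = k *\<^sub>C mC a x"
      unfolding x(1) \<iota>_scale[symmetric]
      by (rule cont_eq[of "\<lambda>a. mC a (\<iota> (k *\<^sub>C x'))" "\<lambda>a. k *\<^sub>C mC a (\<iota> x')"])
        ((intro c x(2) V0_scale)+, simp add: R x(2) V0_scale V.mult_scale_right flip: \<iota>_scale)
  next
    fix x y a x' y' assume x: "x = \<iota> x'" "x' \<in> V0" and y: "y = \<iota> y'" "y' \<in> V0"
    show "mC (mC x a) y = mC x (mC a y)"
      unfolding x(1) y(1)
      by (rule cont_eq[of "\<lambda>a. mC (mC (\<iota> x') a) (\<iota> y')" "\<lambda>a. mC (\<iota> x') (mC a (\<iota> y'))"])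
        ((intro c x(2) y(2))+, simp add: R L x(2) y(2) V.assoc_middle)
    show "mC a (mC x y) = mC (mC a x) y"
      unfolding x(1) y(1) R[OF y(2)]
      by (rule cont_eq[of "\<lambda>a. mC a (\<iota> (mV x' y'))" "\<lambda>a. mC (mC a (\<iota> x')) (\<iota> y')"])
        ((intro c x(2) y(2) V.mult_closed)+, simp add: R x(2) y(2) V.mult_closed V.assoc_right)
  next
    fix a b
    show "sC (a + b) = sC a + sC b"
      by (rule additive_by_density[OF cS]) (simp add: S V.star_add flip: \<iota>_add)
  next
    fix k a
    show "sC (k *\<^sub>C a) = cnj k *\<^sub>C sC a"
      by (rule cont_eq[of "\<lambda>a. sC (k *\<^sub>C a)" "\<lambda>a. cnj k *\<^sub>C sC a"])
        ((intro c)+, simp add: S V.star_scale flip: \<iota>_scale)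
  next
    fix a
    show "sC (sC a) = a"
      by (rule cont_eq[of "\<lambda>a. sC (sC a)" "\<lambda>a. a"]) ((intro c)+, simp add: S V.star_star)
  next
    fix x a x' assume x: "x = \<iota> x'" "x' \<in> V0"
    show "sC (mC a x) = mC (sC x) (sC a)"
      unfolding x(1) S
      by (rule cont_eq[of "\<lambda>a. sC (mC a (\<iota> x'))" "\<lambda>a. mC (\<iota> (sV x')) (sC a)"])
        ((intro c x(2) V.star_closed)+, simp add: S R L x(2) V.star_closed V.star_mult_right)
  qed
  moreover have "norm_topology nC closure_of (\<iota> ` V0) = UNIV"
    unfolding C.closure_of_eq_UNIV_iff
  proof (intro allI impI)
    fix u and e :: real assume "0 < e"
    \<comment> \<open>Half of the tolerance is spent on density of the range of \<iota>, half on
      density of \<open>V0\<close>.\<close>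
    then have e: "0 < e / 2" by simp
    have "norm_topology nC closure_of range \<iota> = UNIV" using compl by (simp add: is_completion_def)
    then obtain v where v: "nC (u - \<iota> v) < e / 2" using e unfolding C.closure_of_eq_UNIV_iff by blast
    obtain x where x: "x \<in> V0" "nV (v - x) < e / 2" using V.dense_approx[OF e] by metis
    have "nC (u - \<iota> x) < e"
      using C.nrm_triangle_sub[of u "\<iota> x" "\<iota> v"] v x(2) nC_\<iota>[of "v - x"] by (simp add: \<iota>_diff)
    with x(1) show "\<exists>w\<in>\<iota> ` V0. nC (u - w) < e" by blast
  qed
  moreover have "norm_complete nC" using compl by (simp add: is_completion_def)
  ultimately show ?thesis
    using star_norm cR C.complex_norm_axioms
    by (intro Banach_quasi_star_algebra.intro normed_quasi_star_algebra.intro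
        normed_quasi_star_algebra_axioms.intro Banach_quasi_star_algebra_axioms.intro) auto
qed

end

text \<open>The completion is any one carried by the type \<open>'c\<close>. Products on it are
  determined only when a factor lies in the image of \<open>T0\<close>, so the Banach property is
  claimed for every continuous extension, together with the existence of one. A Banach quasi
  *-algebra is in particular a normed one, so both readings of the hypothesis are covered.\<close>

theorem mainTheorem2:
  fixes nA :: "'a::complex_vector \<Rightarrow> real" and A0 :: "'a set"
    and mA :: "'a \<Rightarrow> 'a \<Rightarrow> 'a" and sA :: "'a \<Rightarrow> 'a"
    and nB :: "'b::complex_vector \<Rightarrow> real" and B0 :: "'b set"
    and mB :: "'b \<Rightarrow> 'b \<Rightarrow> 'b" and sB :: "'b \<Rightarrow> 'b"
    and \<alpha> :: "('a, 'b) tensor \<Rightarrow> real"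
  assumes "normed_quasi_star_algebra nA A0 mA sA"
    and "normed_quasi_star_algebra nB B0 mB sB"
    and "\<alpha> = injective_norm nA nB \<or> \<alpha> = projective_norm nA nB"
  defines "T0 \<equiv> tensor_subspace A0 B0"
    and "mT \<equiv> tensor_mult A0 mA B0 mB"
    and "sT \<equiv> tensor_star sA sB"
  shows "normed_quasi_star_algebra \<alpha> T0 mT sT \<and>
    (\<forall>(nC :: 'c::complex_vector \<Rightarrow> real) \<iota>. is_completion \<alpha> nC \<iota> \<longrightarrow>
      (\<exists>mC sC. extended_by_continuity nC \<iota> T0 mT sT mC sC) \<and>
      (\<forall>mC sC. extended_by_continuity nC \<iota> T0 mT sT mC sC \<longrightarrow>
        Banach_quasi_star_algebra nC (\<iota> ` T0) mC sC))"
proof -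
  have "complex_norm nA" "complex_norm nB"
    using assms(1,2) by (simp_all add: normed_quasi_star_algebra_def)
  then have "uniform_cross_norm nA nB \<alpha>"
    using assms(3) uniform_cross_norm_injective uniform_cross_norm_projective by blast
  with assms(1,2) have normed: "normed_quasi_star_algebra \<alpha> T0 mT sT"
    unfolding T0_def mT_def sT_def by (rule normed_quasi_star_algebra_tensor)
  moreover have "quasi_star_completion \<alpha> T0 mT sT nC \<iota>" if "is_completion \<alpha> nC \<iota>"
    for nC :: "'c \<Rightarrow> real" and \<iota>
    using normed that by (intro quasi_star_completion.intro quasi_star_completion_axioms.intro)
  ultimately show ?thesis
    using quasi_star_completion.extension_exists quasi_star_completion.extension_Banach by blast
qed

end
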